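(* Let $\bm X_1,\bm X_2,\dots$ be independent copies of a random vector $\bm X\in\mathbb R^d$ whose distribution function $F$ is continuous and whose copula $C_F$ satisfies $C_F\in\mathcal D(G)$, $G(\bm x)=\exp(-\|\bm x\|_D)$, $\bm x\le\bm 0\in\mathbb R^d$, where $\|\cdot\|_D$ is a $D$-norm on $\mathbb R^d$. Suppose in addition that each univariate margin $F_i$ of $F$ is in the domain of attraction of a univariate max-stable distribution $G_i$, i.e. there are constants $a_{ni}>0$, $b_{ni}\in\mathbb R$, $n\in\mathbb N$, such that for $i=1,\dots,d$ $$n(1-F_i(a_{ni}x+b_{ni}))\to_{n\to\infty}-\log(G_i(x))=:-\psi_i(x),\qquad x\in\mathbb R:\ G_i(x)>0.$$ Then, with $\bm a_n:=(a_{n1},\dots,a_{nd})$, $\bm b_n:=(b_{n1},\dots,b_{nd})$ and $\bm\psi(\bm x):=(\psi_1(x_1),\dots,\psi_d(x_d))$, for every $\bm x=(x_1,\dots,x_d)$ with $G_i(x_i)>0$, $i=1,\dots,d$, $$P\left(\frac{\bm X_n-\bm b_n}{\bm a_n}\le\bm x\,\Big|\,\bm X_n\text{ is a simple record}\right)\longrightarrow H_D(\bm\psi(\bm x))\qquad(n\to\infty).$$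
   Context: All operations and relations on vectors ($\max$, $\min$, quotients, $\le$, ...) are componentwise; $\bm 1=(1,\dots,1)$. $\|\cdot\|_D$ is a $D$-norm on $\mathbb R^d$ if there is a random vector $\bm Z=(Z_1,\dots,Z_d)\ge\bm 0$ with $E(Z_j)=1$, $1\le j\le d$, such that $\|\bm x\|_D=E(\max_{1\le j\le d}|x_j|Z_j)$ for $\bm x\in\mathbb R^d$; then $G(\bm x)=\exp(-\|\bm x\|_D)$, $\bm x\le\bm 0$, is a standard max-stable distribution function on $\mathbb R^d$. For a continuous distribution function $F$ on $\mathbb R^d$ with univariate margins $F_i$ and quantile functions $F_i^{-1}$, its copula is $C_F(\bm u)=F(F_1^{-1}(u_1),\dots,F_d^{-1}(u_d))$, $\bm u\in[0,1]^d$. $C\in\mathcal D(G)$ means $C^n(\bm 1+\bm x/n)\to_{n\to\infty}G(\bm x)$ for all $\bm x\le\bm 0$. With $\bm\eta$ a random vector with distribution function $G$, define for $\bm y\le\bm 0\in\mathbb R^d$ $$H_D(\bm y):=\frac{E(\|\min(\bm y,\bm\eta)\|_D)-\|\bm y\|_D}{E(\|\bm\eta\|_D)}.$$ $\bm X_n$ is a simple record if $\bm X_n\not\le\max_{1\le i\le n-1}\bm X_i$. *)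

theory Defs
  imports "HOL-Probability.Probability"
begin

text \<open>On \<^typ>\<open>real ^ 'd\<close> the library's order \<open>\<le>\<close>, the lattice operation \<^const>\<open>inf\<close> and the
  constant \<open>1\<close> are componentwise; \<^const>\<open>inf\<close> is the componentwise minimum.\<close>

text \<open>Only the law of the generating vector \<open>Z\<close> enters, so it is no restriction to take the
  probability space on which \<open>Z\<close> lives to have underlying type \<^typ>\<open>real ^ 'd\<close>.
  The Bochner integral of a non-integrable function is \<open>0\<close> by convention, hence
  \<^const>\<open>has_bochner_integral\<close>.\<close>

definition D_norm :: "(real ^ 'd \<Rightarrow> real) \<Rightarrow> bool" where
  "D_norm N \<longleftrightarrow>
    (\<exists>(M :: (real ^ 'd) measure) (Z :: real ^ 'd \<Rightarrow> real ^ 'd).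
       prob_space M \<and> Z \<in> borel_measurable M \<and>
       (\<forall>\<omega>\<in>space M. 0 \<le> Z \<omega>) \<and>
       (\<forall>j. has_bochner_integral M (\<lambda>\<omega>. Z \<omega> $ j) 1) \<and>
       (\<forall>x. N x = (LINT \<omega>|M. (MAX j. \<bar>x $ j\<bar> * Z \<omega> $ j))))"

text \<open>The value of \<open>G\<close> on the nonpositive orthant; since \<open>G(0) = 1\<close>, these values determine the
  distribution.\<close>

definition std_max_stable :: "(real ^ 'd \<Rightarrow> real) \<Rightarrow> real ^ 'd \<Rightarrow> real" where
  "std_max_stable N x = exp (- N x)"

text \<open>Distribution functions are attached to laws on \<^typ>\<open>real ^ 'd\<close>, as for \<^const>\<open>cdf\<close> on the
  reals.\<close>

definition joint_cdf :: "(real ^ 'd) measure \<Rightarrow> real ^ 'd \<Rightarrow> real" where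
  "joint_cdf \<mu> x = measure \<mu> {..x}"

definition margin :: "(real ^ 'd) measure \<Rightarrow> 'd \<Rightarrow> real measure" where
  "margin \<mu> i = distr \<mu> borel (\<lambda>x. x $ i)"

text \<open>The quantile function and the arguments of the distribution functions are extended reals, so
  that \<open>F\<^sup>-\<^sup>1(0) = -\<infinity>\<close> and a possibly infinite \<open>F\<^sup>-\<^sup>1(1)\<close> make sense and the copula is
  defined on the whole closed unit cube.\<close>

definition joint_cdf_ereal :: "(real ^ 'd) measure \<Rightarrow> ('d \<Rightarrow> ereal) \<Rightarrow> real" where
  "joint_cdf_ereal \<mu> t = measure \<mu> {x. \<forall>i. ereal (x $ i) \<le> t i}"

definition quantile :: "real measure \<Rightarrow> real \<Rightarrow> ereal" where
  "quantile \<nu> u = Inf {t :: ereal. u \<le> measure \<nu> {s. ereal s \<le> t}}"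

definition copula :: "(real ^ 'd) measure \<Rightarrow> real ^ 'd \<Rightarrow> real" where
  "copula \<mu> u = joint_cdf_ereal \<mu> (\<lambda>i. quantile (margin \<mu> i) (u $ i))"

text \<open>For fixed \<open>x \<le> 0\<close> the point \<open>1 + x/n\<close> lies in the unit cube for all large \<open>n\<close>, so values
  of \<open>C\<close> outside the cube are irrelevant.\<close>

definition copula_domain_of_attraction ::
  "(real ^ 'd \<Rightarrow> real) \<Rightarrow> (real ^ 'd \<Rightarrow> real) \<Rightarrow> bool" where
  "copula_domain_of_attraction C G \<longleftrightarrow>
    (\<forall>x\<le>0. (\<lambda>n. C (1 + x /\<^sub>R real n) ^ n) \<longlonglongrightarrow> G x)"

definition max_stable :: "(real \<Rightarrow> real) \<Rightarrow> bool" where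
  "max_stable G \<longleftrightarrow>
    (\<exists>\<nu>. real_distribution \<nu> \<and> G = cdf \<nu>) \<and>
    (\<forall>n\<ge>1::nat. \<exists>a>0. \<exists>b. \<forall>x. G (a * x + b) ^ n = G x)"

text \<open>Here \<open>\<eta>\<close> is a random vector on the probability space \<open>E\<close>, with distribution function
  \<^term>\<open>std_max_stable N\<close> in all uses.\<close>

definition H_D ::
  "(real ^ 'd \<Rightarrow> real) \<Rightarrow> 'e measure \<Rightarrow> ('e \<Rightarrow> real ^ 'd) \<Rightarrow> real ^ 'd \<Rightarrow> real" where
  "H_D N E \<eta> y =
    ((LINT \<omega>|E. N (inf y (\<eta> \<omega>))) - N y) / (LINT \<omega>|E. N (\<eta> \<omega>))"

text \<open>Sequences are indexed from \<open>1\<close>. The supremum is taken in the extended reals: for \<open>n = 1\<close> it is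
  over the empty set, hence \<open>-\<infinity>\<close>, and the first observation is a record.\<close>

definition simple_record :: "(nat \<Rightarrow> 'a \<Rightarrow> real ^ 'd) \<Rightarrow> nat \<Rightarrow> 'a \<Rightarrow> bool" where
  "simple_record X n \<omega> \<longleftrightarrow>
    \<not> (\<forall>j. ereal (X n \<omega> $ j) \<le> (SUP i\<in>{1..<n}. ereal (X i \<omega> $ j)))"

end

theory Submission
  imports Defs
begin

text \<open>Applying the marginal distribution functions to the observations preserves all comparisons
  almost surely and yields i.i.d. vectors \<open>U\<^sub>n\<close> with distribution function \<open>K\<close> (the copula on the
  unit cube). Let \<open>W\<^sub>n\<close> be the maximum of \<open>U\<^sub>1, \<dots>, U\<^sub>n\<^sub>-\<^sub>1\<close> and \<open>g\<^sub>n v = n (1 - K (1 + v/n))\<close>. Since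
  \<open>W\<^sub>n\<close> is independent of \<open>U\<^sub>n\<close>, with \<open>V\<^sub>n = n (W\<^sub>n - 1)\<close>,
  \<open>n P (U\<^sub>n \<le> 1 + y/n, \<not> U\<^sub>n \<le> W\<^sub>n) = E (g\<^sub>n (min y V\<^sub>n)) - g\<^sub>n y\<close>.
  The domain of attraction condition says that \<open>g\<^sub>n\<close> tends pointwise to the D-norm and that the
  distribution functions of \<open>V\<^sub>n\<close> tend to \<open>G\<close>. As the margins of \<open>K\<close> are uniform, the \<open>g\<^sub>n\<close> are
  equi-Lipschitz and the \<open>V\<^sub>n\<close> have uniform exponential tails, so the expectations converge as well.
  The case \<open>y = 0\<close> is the record probability.\<close>

section \<open>The marginal probability integral transform\<close>

lemma (in finite_measure) AE_iff_of_subset_measure_eq: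
  assumes "A \<subseteq> B" "A \<in> sets M" "B \<in> sets M" "measure M A = measure M B"
  shows "AE x in M. x \<in> A \<longleftrightarrow> x \<in> B"
proof (rule AE_I')
  have "measure M (B - A) = 0"
    using assms by (simp add: finite_measure_Diff)
  then show "B - A \<in> null_sets M"
    using assms by (auto simp: null_sets_def emeasure_eq_measure)
  show "{x \<in> space M. (x \<in> A) \<noteq> (x \<in> B)} \<subseteq> B - A"
    using assms by auto
qed

text \<open>A down-set of the line is empty, everything, or a half-line ending at its supremum
  \<open>m\<close>. In the first two cases the limits of the distribution function at -infinity and
  infinity force \<open>u\<close> to be 0 or 1; in the third its value at \<open>m\<close> is
  squeezed to \<open>u\<close> from both sides.\<close>

lemma (in real_distribution) measure_down_set_eq:
  assumes cont: "\<And>s. isCont (cdf M) s"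
    and down: "\<And>s t. t \<in> D \<Longrightarrow> s \<le> t \<Longrightarrow> s \<in> D"
    and le: "\<And>s. s \<in> D \<Longrightarrow> cdf M s \<le> u"
    and ge: "\<And>s. s \<notin> D \<Longrightarrow> u \<le> cdf M s"
    and u: "0 \<le> u" "u \<le> 1"
  shows "measure M D = u"
proof -
  consider "D = {}" | "D = UNIV" | d e where "d \<in> D" "e \<notin> D"
    by auto
  then show ?thesis
  proof cases
    case 1
    with ge have "u \<le> 0"
      by (intro tendsto_lowerbound[OF cdf_lim_at_bot]) (auto intro!: always_eventually)
    with 1 u show ?thesis by simp
  next
    case 2
    with le have "1 \<le> u"
      by (intro tendsto_upperbound[OF cdf_lim_at_top_prob]) (auto intro!: always_eventually)
    with 2 u show ?thesis using prob_space by simp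
  next
    case (3 d e)
    define m where "m = Sup D"
    have bdd: "bdd_above D"
      using 3 down by (meson bdd_above.I linorder_le_cases)
    have inD: "s \<in> D" if "s < m" for s
      using that 3 down bdd unfolding m_def by (metis empty_iff less_cSup_iff less_imp_le)
    have notinD: "s \<notin> D" if "m < s" for s
      using that bdd unfolding m_def by (meson cSup_upper leD)
    \<comment> \<open>Continuity rules out an atom at \<open>m\<close>, so it is immaterial whether
      \<open>m\<close> belongs to \<open>D\<close>.\<close>
    have pt: "measure M {m} = 0"
      using cont[of m] isCont_cdf by simp
    have L: "cdf M m \<le> u"
    proof (rule tendsto_upperbound)
      show "(cdf M \<longlongrightarrow> cdf M m) (at_left m)"
        using cont[of m] by (simp add: isCont_def filterlim_at_split)
      show "\<forall>\<^sub>F s in at_left m. cdf M s \<le> u"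
        by (auto simp: eventually_at_filter intro!: always_eventually le inD)
    qed simp
    have R: "u \<le> cdf M m"
    proof (rule tendsto_lowerbound)
      show "(cdf M \<longlongrightarrow> cdf M m) (at_right m)"
        using cont[of m] by (simp add: isCont_def filterlim_at_split)
      show "\<forall>\<^sub>F s in at_right m. u \<le> cdf M s"
        by (auto simp: eventually_at_filter intro!: always_eventually ge notinD)
    qed simp
    have "measure M {..m} = measure M {..<m} + measure M {m}"
      by (subst finite_measure_Union[symmetric]) (auto intro!: arg_cong[where f="measure M"])
    moreover have "D = (if m \<in> D then {..m} else {..<m})"
      using inD notinD by (auto simp: set_eq_iff le_less) (metis linorder_cases)+
    then have "D = {..<m} \<or> D = {..m}"
      by presburger
    ultimately show ?thesis
      using pt L R by (auto simp: cdf_def)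
  qed
qed

lemma (in real_distribution) measure_cdf_le:
  assumes "\<And>s. isCont (cdf M) s" "0 \<le> u" "u \<le> 1"
  shows "measure M {s. cdf M s \<le> u} = u"
  by (rule measure_down_set_eq) (use assms in \<open>auto intro: order_trans[OF cdf_nondecreasing]\<close>)

text \<open>A point \<open>s\<close> with \<open>F s \<le> F t\<close> for some \<open>t < s\<close> lies, for a rational \<open>p\<close> between
  \<open>t\<close> and \<open>s\<close>, in \<open>{F \<le> F p} - {..p}\<close>, which is a null set.\<close>

lemma (in real_distribution) AE_cdf_le_imp_le:
  assumes "\<And>s. isCont (cdf M) s"
  shows "AE s in M. \<forall>t. cdf M s \<le> cdf M t \<longrightarrow> s \<le> t"
proof -
  have "cdf M \<in> borel_measurable borel"
    using assms by (intro borel_measurable_continuous_onI) (simp add: continuous_on_eq_continuous_at)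
  then have meas[measurable]: "{s. cdf M s \<le> u} \<in> sets borel" for u
    by measurable
  have "AE s in M. s \<in> {..p} \<longleftrightarrow> s \<in> {s. cdf M s \<le> cdf M p}" for p
    using assms measure_cdf_le[of "cdf M p"]
    by (intro AE_iff_of_subset_measure_eq)
       (auto intro: cdf_nondecreasing simp: cdf_nonneg cdf_bounded_prob, simp add: cdf_def)
  then have "AE s in M. \<forall>p::rat. s \<in> {..of_rat p} \<longleftrightarrow> s \<in> {s. cdf M s \<le> cdf M (of_rat p)}"
    by (simp add: AE_all_countable)
  then show ?thesis
  proof eventually_elim
    case (elim s)
    show ?case
    proof (intro allI impI, rule ccontr)
      fix t assume t: "cdf M s \<le> cdf M t" "\<not> s \<le> t"
      then obtain p where "t < of_rat p" "of_rat p < s"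
        by (meson not_le of_rat_dense)
      moreover from this t have "cdf M s \<le> cdf M (of_rat p)"
        using cdf_nondecreasing[of t "of_rat p"] by simp
      ultimately show False
        using elim by (auto simp: not_le dest: spec[of _ p])
    qed
  qed
qed

text \<open>Where the distribution function is flat at level \<open>u\<close>, the quantile is the
  left end of the flat stretch, while the right-hand condition holds up to its right end; so the
  equivalence holds in general only almost surely. Both sets have mass \<open>u\<close> and the
  first is contained in the second.\<close>

lemma (in real_distribution) AE_le_quantile_iff:
  assumes cont: "\<And>s. isCont (cdf M) s" and u: "0 \<le> u" "u \<le> 1"
  shows "AE s in M. ereal s \<le> quantile M u \<longleftrightarrow> cdf M s \<le> u"
proof -
  define A where "A = {s. ereal s \<le> quantile M u}"
  have below: "cdf M s < u" if "ereal s < quantile M u" for s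
  proof (rule ccontr)
    assume "\<not> cdf M s < u"
    then have "quantile M u \<le> ereal s"
      unfolding quantile_def by (intro Inf_lower) (simp add: cdf_def atMost_def)
    with that show False by simp
  qed
  have above: "u \<le> cdf M s" if less: "quantile M u < ereal s" for s
  proof -
    obtain t where t: "u \<le> measure M {s. ereal s \<le> t}" "t < ereal s"
      using less unfolding quantile_def by (auto simp: Inf_less_iff)
    have "measure M {s. ereal s \<le> t} \<le> measure M {..s}"
      by (intro finite_measure_mono) (use t(2) in \<open>auto dest: order.strict_trans1\<close>)
    with t(1) show ?thesis by (simp add: cdf_def)
  qed
  \<comment> \<open>The point \<open>s\<close> may be the quantile itself, where
    \<open>below\<close> is silent; continuity carries the bound over from the left.\<close>
  have le: "cdf M s \<le> u" if "s \<in> A" for s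
  proof (rule tendsto_upperbound)
    show "(cdf M \<longlongrightarrow> cdf M s) (at_left s)"
      using cont[of s] by (simp add: isCont_def filterlim_at_split)
    have "cdf M t \<le> u" if "t < s" for t
      using \<open>s \<in> A\<close> that by (intro less_imp_le below) (auto simp: A_def intro: less_le_trans[of _ "ereal s"])
    then show "\<forall>\<^sub>F t in at_left s. cdf M t \<le> u"
      by (auto simp: eventually_at_filter intro!: always_eventually)
  qed simp
  have "measure M A = u"
    by (rule measure_down_set_eq)
       (use assms le above in \<open>auto simp: A_def not_le intro: order_trans[of "ereal _" "ereal _"]\<close>)
  moreover have "cdf M \<in> borel_measurable borel"
    using cont by (intro borel_measurable_continuous_onI) (simp add: continuous_on_eq_continuous_at)
  then have "{s. cdf M s \<le> u} \<in> sets borel"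
    by measurable
  moreover have "A \<in> sets borel"
    unfolding A_def by measurable
  ultimately have "AE s in M. s \<in> A \<longleftrightarrow> s \<in> {s. cdf M s \<le> u}"
    by (intro AE_iff_of_subset_measure_eq) (use measure_cdf_le[OF assms] le in auto)
  then show ?thesis by (simp add: A_def)
qed

section \<open>Margins of a multivariate law\<close>

lemma real_distribution_margin:
  fixes \<mu> :: "(real ^ 'd) measure"
  assumes "prob_space \<mu>" and [measurable_cong]: "sets \<mu> = sets borel"
  shows "real_distribution (margin \<mu> i)"
proof -
  have "prob_space (margin \<mu> i)"
    unfolding margin_def by (intro prob_space.prob_space_distr assms(1)) measurable
  then show ?thesis
    by (simp add: real_distribution_def real_distribution_axioms_def margin_def)
qed

text \<open>A jump of the margin at \<open>c\<close> would be mass on the hyperplane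
  \<open>x $ i = c\<close>. The hyperplane is exhausted by its parts \<open>A k\<close> with all
  coordinates at most \<open>k\<close>, and each nonempty part lies in a difference of two lower
  orthants whose masses come together by joint continuity.\<close>

lemma isCont_cdf_margin:
  fixes \<mu> :: "(real ^ 'd) measure"
  assumes "prob_space \<mu>" and [measurable_cong]: "sets \<mu> = sets borel"
    and cont: "continuous_on UNIV (joint_cdf \<mu>)"
  shows "isCont (cdf (margin \<mu> i)) c"
proof -
  interpret prob_space \<mu> by fact
  interpret m: real_distribution "margin \<mu> i"
    using assms(1,2) by (rule real_distribution_margin)
  have sp: "space \<mu> = UNIV"
    using sets_eq_imp_space_eq[OF assms(2)] by simp
  define A where "A k = {x. x $ i = c \<and> (\<forall>j. x $ j \<le> real k)}" for k
  have [measurable]: "A k \<in> sets \<mu>" for k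
    unfolding A_def by measurable
  have "measure \<mu> (A k) \<le> 0" for k
  proof -
    \<comment> \<open>\<open>p e\<close> is the corner of an orthant that contains
      \<open>A k\<close> for \<open>e = 0\<close> and misses the hyperplane for
      \<open>e > 0\<close>.\<close>
    define p where "p e = (\<chi> j. if j = i then c - e else real k)" for e :: real
    have "((\<lambda>e. joint_cdf \<mu> (p 0) - joint_cdf \<mu> (p e)) \<longlongrightarrow> 0) (at_right 0)"
    proof -
      have "isCont p 0"
        unfolding p_def by (simp add: isCont_def vec_eq_iff) (intro tendsto_vec_lambda, auto intro!: tendsto_eq_intros)
      moreover have "isCont (joint_cdf \<mu>) (p 0)"
        using cont by (simp add: continuous_on_eq_continuous_at)
      ultimately have "isCont (\<lambda>e. joint_cdf \<mu> (p e)) 0"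
        by (rule isCont_o2)
      then have "((\<lambda>e. joint_cdf \<mu> (p e)) \<longlongrightarrow> joint_cdf \<mu> (p 0)) (at_right 0)"
        by (simp add: isCont_def filterlim_at_split)
      from tendsto_diff[OF tendsto_const[of "joint_cdf \<mu> (p 0)"] this] show ?thesis by simp
    qed
    moreover have "measure \<mu> (A k) \<le> joint_cdf \<mu> (p 0) - joint_cdf \<mu> (p e)" if "e > 0" for e
    proof (cases "c \<le> real k")
      case True
      have sub: "{..p e} \<subseteq> {..p 0}" "A k \<subseteq> {..p 0} - {..p e}"
        using that by (force simp: p_def A_def less_eq_vec_def split: if_splits)+
      then have "measure \<mu> (A k) \<le> measure \<mu> ({..p 0} - {..p e})"
        by (intro finite_measure_mono) auto
      also have "\<dots> = joint_cdf \<mu> (p 0) - joint_cdf \<mu> (p e)"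
        using sub by (simp add: finite_measure_Diff joint_cdf_def)
      finally show ?thesis .
    next
      case False
      then have "A k = {}" by (auto simp: A_def)
      moreover have "joint_cdf \<mu> (p e) \<le> joint_cdf \<mu> (p 0)"
        unfolding joint_cdf_def using that
        by (intro finite_measure_mono) (force simp: p_def less_eq_vec_def split: if_splits)+
      ultimately show ?thesis by simp
    qed
    then have "\<forall>\<^sub>F e in at_right 0. measure \<mu> (A k) \<le> joint_cdf \<mu> (p 0) - joint_cdf \<mu> (p e)"
      by (simp add: eventually_at_filter)
    ultimately show ?thesis
      by (rule tendsto_lowerbound) simp
  qed
  then have "measure \<mu> (A k) = 0" for k
    by (simp add: measure_le_0_iff)
  then have "(\<Union>k. A k) \<in> null_sets \<mu>"
    by (intro null_sets_UN) (auto simp: null_sets_def emeasure_eq_measure)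
  moreover have "(\<Union>k. A k) = {x. x $ i = c}"
  proof (intro equalityI subsetI)
    fix x assume "x \<in> {x. x $ i = c}"
    moreover obtain k :: nat where "Max (range (\<lambda>j. x $ j)) \<le> real k"
      using real_arch_simple by blast
    then have "\<forall>j. x $ j \<le> real k"
      by simp
    ultimately show "x \<in> (\<Union>k. A k)"
      by (auto simp: A_def)
  qed (auto simp: A_def)
  ultimately have "measure \<mu> {x. x $ i = c} = 0"
    by (simp add: measure_eq_0_null_sets)
  then have "measure (margin \<mu> i) {c} = 0"
    unfolding margin_def by (subst measure_distr) (auto simp: vimage_def sp)
  then show ?thesis
    by (simp add: m.isCont_cdf)
qed

section \<open>The vector-valued transform and the copula\<close>

definition cdf_transform :: "(real ^ 'd) measure \<Rightarrow> real ^ 'd \<Rightarrow> real ^ 'd" where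
  "cdf_transform \<mu> x = (\<chi> i. cdf (margin \<mu> i) (x $ i))"

lemma measurable_cdf_transform:
  fixes \<mu> :: "(real ^ 'd) measure"
  assumes "prob_space \<mu>" "sets \<mu> = sets borel" "continuous_on UNIV (joint_cdf \<mu>)"
  shows "cdf_transform \<mu> \<in> borel_measurable borel"
proof -
  have "continuous_on UNIV (cdf (margin \<mu> i))" for i
    using isCont_cdf_margin[OF assms] by (simp add: continuous_on_eq_continuous_at)
  then have "continuous_on UNIV (cdf_transform \<mu>)"
    unfolding cdf_transform_def
    by (auto intro!: continuous_on_vec_lambda continuous_on_compose2[of UNIV "cdf _" _ "\<lambda>x. x $ _"] continuous_intros)
  then show ?thesis
    by (rule borel_measurable_continuous_onI)
qed

lemma AE_margin:
  fixes \<mu> :: "(real ^ 'd) measure"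
  assumes [measurable_cong]: "sets \<mu> = sets borel" and "\<And>i. AE s in margin \<mu> i. P i s"
  shows "AE x in \<mu>. \<forall>i. P i (x $ i)"
proof -
  have "AE x in \<mu>. P i (x $ i)" for i
    using assms(2)[of i] unfolding margin_def by (rule AE_distrD[rotated]) measurable
  then show ?thesis
    by (simp add: AE_all_countable)
qed

text \<open>The exceptional null set is the same for all \<open>t\<close>, so \<open>t\<close> may
  later be a random vector such as the maximum of the earlier observations.\<close>

lemma AE_cdf_transform_le_iff:
  fixes \<mu> :: "(real ^ 'd) measure"
  assumes "prob_space \<mu>" "sets \<mu> = sets borel" "continuous_on UNIV (joint_cdf \<mu>)"
  shows "AE x in \<mu>. \<forall>t. cdf_transform \<mu> x \<le> cdf_transform \<mu> t \<longleftrightarrow> x \<le> t"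
proof -
  have "AE s in margin \<mu> i. \<forall>t. cdf (margin \<mu> i) s \<le> cdf (margin \<mu> i) t \<longrightarrow> s \<le> t" for i
    using assms by (intro real_distribution.AE_cdf_le_imp_le real_distribution_margin isCont_cdf_margin)
  then have "AE x in \<mu>. \<forall>i. \<forall>t. cdf (margin \<mu> i) (x $ i) \<le> cdf (margin \<mu> i) t \<longrightarrow> x $ i \<le> t"
    by (rule AE_margin[OF assms(2)])
  then show ?thesis
  proof eventually_elim
    case (elim x)
    moreover have "cdf (margin \<mu> i) s \<le> cdf (margin \<mu> i) t" if "s \<le> t" for i s t
      using real_distribution_margin[OF assms(1,2), of i] that
      by (intro finite_borel_measure.cdf_nondecreasing real_distribution.finite_borel_measure_M)
    ultimately show ?case
      by (auto simp: cdf_transform_def less_eq_vec_def)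
  qed
qed

text \<open>\<open>AE_le_quantile_iff\<close> trades each condition that \<open>x $ i\<close> is
  below a quantile for one on \<open>cdf (margin \<mu> i) (x $ i)\<close>. On the cube the copula is
  thus the distribution function of an actual law.\<close>

lemma copula_eq_joint_cdf:
  fixes \<mu> :: "(real ^ 'd) measure"
  assumes "prob_space \<mu>" "sets \<mu> = sets borel" "continuous_on UNIV (joint_cdf \<mu>)"
    and u: "\<And>i. 0 \<le> u $ i" "\<And>i. u $ i \<le> 1"
  shows "copula \<mu> u = joint_cdf (distr \<mu> borel (cdf_transform \<mu>)) u"
proof -
  note [measurable] = measurable_cdf_transform[OF assms(1-3)]
  note [measurable_cong] = assms(2)
  interpret prob_space \<mu> by fact
  have sp: "space \<mu> = UNIV"
    using sets_eq_imp_space_eq[OF assms(2)] by simp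
  have "AE s in margin \<mu> i. ereal s \<le> quantile (margin \<mu> i) (u $ i) \<longleftrightarrow> cdf (margin \<mu> i) s \<le> u $ i" for i
    using assms by (intro real_distribution.AE_le_quantile_iff real_distribution_margin isCont_cdf_margin)
  then have "AE x in \<mu>. \<forall>i. ereal (x $ i) \<le> quantile (margin \<mu> i) (u $ i) \<longleftrightarrow> cdf (margin \<mu> i) (x $ i) \<le> u $ i"
    by (rule AE_margin[OF assms(2)])
  then have "AE x in \<mu>. x \<in> {x. \<forall>i. ereal (x $ i) \<le> quantile (margin \<mu> i) (u $ i)} \<longleftrightarrow>
      x \<in> {x. cdf_transform \<mu> x \<le> u}"
    by eventually_elim (auto simp: cdf_transform_def less_eq_vec_def)
  then have "copula \<mu> u = measure \<mu> {x. cdf_transform \<mu> x \<le> u}"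
    unfolding copula_def joint_cdf_ereal_def
    by (intro measure_eq_AE) (auto simp: less_eq_vec_def)
  then show ?thesis
    by (simp add: joint_cdf_def measure_distr vimage_def sp)
qed

lemma measure_cdf_transform_margin:
  fixes \<mu> :: "(real ^ 'd) measure"
  assumes "prob_space \<mu>" "sets \<mu> = sets borel" "continuous_on UNIV (joint_cdf \<mu>)"
    and "0 \<le> s" "s \<le> 1"
  shows "measure (distr \<mu> borel (cdf_transform \<mu>)) {u. u $ i \<le> s} = s"
proof -
  note [measurable] = measurable_cdf_transform[OF assms(1-3)]
  note [measurable_cong] = assms(2)
  have sp: "space \<mu> = UNIV"
    using sets_eq_imp_space_eq[OF assms(2)] by simp
  have [measurable]: "cdf (margin \<mu> i) \<in> borel_measurable borel"
    using isCont_cdf_margin[OF assms(1-3)]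
    by (intro borel_measurable_continuous_onI) (simp add: continuous_on_eq_continuous_at)
  have "measure (distr \<mu> borel (cdf_transform \<mu>)) {u. u $ i \<le> s}
      = measure \<mu> {x. cdf (margin \<mu> i) (x $ i) \<le> s}"
    by (subst measure_distr) (auto simp: vimage_def sp cdf_transform_def)
  also have "\<dots> = measure (margin \<mu> i) {t. cdf (margin \<mu> i) t \<le> s}"
    using measure_distr[of "\<lambda>x. x $ i" \<mu> borel "{t. cdf (margin \<mu> i) t \<le> s}"]
    by (simp add: margin_def[symmetric] vimage_def sp)
  also have "\<dots> = s"
    using assms by (intro real_distribution.measure_cdf_le real_distribution_margin isCont_cdf_margin)
  finally show ?thesis .
qed

section \<open>Convergence of integrals of equi-Lipschitz functions\<close>

text \<open>Inclusion-exclusion, one coordinate at a time: imposing a lower bound in coordinate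
  \<open>k\<close> removes the same set with its upper corner lowered to \<open>a $ k\<close> there.
  All corners that occur stay between \<open>a\<close> and \<open>b\<close>, hence in the orthant
  where convergence is assumed.\<close>

lemma tendsto_measure_half_open_box:
  fixes \<nu> :: "nat \<Rightarrow> (real ^ 'd) measure" and \<rho> :: "(real ^ 'd) measure" and a b :: "real ^ 'd"
  assumes "\<And>n. prob_space (\<nu> n)" "\<And>n. sets (\<nu> n) = sets borel"
    and "prob_space \<rho>" "sets \<rho> = sets borel"
    and cdf: "\<And>v. v \<le> 0 \<Longrightarrow> (\<lambda>n. joint_cdf (\<nu> n) v) \<longlonglongrightarrow> joint_cdf \<rho> v"
    and "a \<le> b" "b \<le> 0"
  shows "(\<lambda>n. measure (\<nu> n) {v. v \<le> b \<and> (\<forall>i. a $ i < v $ i)}) \<longlonglongrightarrow>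
    measure \<rho> {v. v \<le> b \<and> (\<forall>i. a $ i < v $ i)}"
proof -
  \<comment> \<open>Lower bounds are imposed only in the coordinates of \<open>S\<close>: the empty
    set gives an orthant, \<open>UNIV\<close> the box.\<close>
  define A where "A S b = {v. v \<le> b \<and> (\<forall>i\<in>S. a $ i < v $ i)}" for S and b :: "real ^ 'd"
  have A[measurable]: "A S b \<in> sets borel" for S b
    unfolding A_def less_eq_vec_def by measurable
  have main: "(\<lambda>n. measure (\<nu> n) (A S b)) \<longlonglongrightarrow> measure \<rho> (A S b)" for S
    using finite[of S] \<open>a \<le> b\<close> \<open>b \<le> 0\<close>
  proof (induction S arbitrary: b rule: finite_induct)
    case empty
    then show ?case
      using cdf[of b] by (simp add: A_def joint_cdf_def atMost_def)
  next
    case (insert k S)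
    define b' where "b' = (\<chi> i. if i = k then a $ i else b $ i)"
    have b': "a \<le> b'" "b' \<le> b"
      using insert.prems by (auto simp: b'_def less_eq_vec_def)
    then have sub: "A S b' \<subseteq> A S b"
      by (auto simp: A_def)
    have eq: "A (insert k S) b = A S b - A S b'"
    proof (intro equalityI subsetI)
      fix v assume "v \<in> A (insert k S) b"
      then show "v \<in> A S b - A S b'"
        by (auto simp: A_def b'_def less_eq_vec_def dest!: spec[of _ k])
    next
      fix v assume v: "v \<in> A S b - A S b'"
      then obtain i where "\<not> v $ i \<le> b' $ i" and vb: "\<And>i. v $ i \<le> b $ i"
        by (auto simp: A_def less_eq_vec_def)
      then have "a $ k < v $ k"
        by (auto simp: b'_def not_le split: if_splits) (use vb[of i] in simp)
      with v show "v \<in> A (insert k S) b"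
        by (auto simp: A_def)
    qed
    have diff: "measure \<sigma> (A (insert k S) b) = measure \<sigma> (A S b) - measure \<sigma> (A S b')"
      if "prob_space \<sigma>" "sets \<sigma> = sets borel" for \<sigma>
    proof -
      interpret prob_space \<sigma> by fact
      show ?thesis
        unfolding eq using sub by (intro finite_measure_Diff) (auto simp: that)
    qed
    show ?case
      unfolding diff[OF assms(1,2)] diff[OF assms(3,4)]
      using b' insert.prems by (intro tendsto_diff insert.IH) auto
  qed
  from main[of UNIV] show ?thesis
    by (simp add: A_def)
qed

section \<open>Second moments under exponential tails\<close>

text \<open>With \<open>z = (k + 1) / 4\<close>, the inequality
  \<open>z\<^sup>2 / 2 \<le> exp z\<close> bounds the polynomial factor by
  \<open>32 * exp z\<close>. This uses up half of the exponential decay and leaves a geometric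
  series of ratio \<open>exp (- 1/4)\<close>.\<close>

lemma summable_quadratic_exp: "summable (\<lambda>k. (real k + 1)\<^sup>2 * exp (- real k / 2))"
proof (rule summable_comparison_test')
  show "summable (\<lambda>k. 32 * exp (1/4) * exp (- 1/4) ^ k :: real)"
    by (intro summable_mult summable_geometric) simp
  fix k :: nat
  have "(real k + 1)\<^sup>2 \<le> 32 * exp ((real k + 1) / 4)"
    using exp_lower_Taylor_quadratic[of "(real k + 1) / 4"] by (simp add: field_simps power2_eq_square)
  then have "(real k + 1)\<^sup>2 * exp (- real k / 2) \<le> 32 * exp ((real k + 1) / 4) * exp (- real k / 2)"
    by (intro mult_right_mono) auto
  also have "\<dots> = 32 * exp (1/4) * exp (- 1/4) ^ k"
    by (simp add: exp_of_nat_mult[symmetric] mult.assoc flip: exp_add) (simp add: field_simps)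
  finally show "norm ((real k + 1)\<^sup>2 * exp (- real k / 2)) \<le> 32 * exp (1/4) * exp (- 1/4) ^ k"
    by simp
qed

text \<open>Bounds the second moment of every nonnegative variable whose tail at \<open>s\<close> is
  at most \<open>exp (- s / 2)\<close>. It depends on no particular law, which makes the later error
  estimates uniform in \<open>n\<close>.\<close>

definition second_moment_bound :: real where
  "second_moment_bound = (\<Sum>k. (real k + 1)\<^sup>2 * exp (- real k / 2))"

lemma second_moment_bound_nonneg: "0 \<le> second_moment_bound"
  unfolding second_moment_bound_def by (intro suminf_nonneg summable_quadratic_exp) simp

text \<open>With \<open>k\<close> the integer part of \<open>Y x\<close>, the single term
  \<open>(k + 1)\<^sup>2\<close> of the series already dominates \<open>(Y x)\<^sup>2\<close>;
  integrating termwise leaves tail probabilities at integers.\<close>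

lemma (in prob_space) nn_integral_square_exponential_tail:
  fixes Y :: "'a \<Rightarrow> real"
  assumes [measurable]: "Y \<in> borel_measurable M"
    and nonneg: "AE x in M. 0 \<le> Y x"
    and tail: "\<And>s. 0 \<le> s \<Longrightarrow> prob {x \<in> space M. s \<le> Y x} \<le> exp (- s / 2)"
  shows "(\<integral>\<^sup>+x. ennreal ((Y x)\<^sup>2) \<partial>M) \<le> ennreal second_moment_bound"
proof -
  let ?A = "\<lambda>k. {x \<in> space M. real k \<le> Y x}"
  have "(\<integral>\<^sup>+x. ennreal ((Y x)\<^sup>2) \<partial>M) \<le> (\<integral>\<^sup>+x. (\<Sum>k. ennreal ((real k + 1)\<^sup>2) * indicator (?A k) x) \<partial>M)"
  proof (rule nn_integral_mono_AE, use nonneg AE_space in \<open>eventually_elim\<close>)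
    fix x assume "0 \<le> Y x" and x: "x \<in> space M"
    show "ennreal ((Y x)\<^sup>2) \<le> (\<Sum>k. ennreal ((real k + 1)\<^sup>2) * indicator (?A k) x)"
    proof -
      define k where "k = nat \<lfloor>Y x\<rfloor>"
      have k: "real k \<le> Y x" "Y x \<le> real k + 1"
        using \<open>0 \<le> Y x\<close> by (auto simp: k_def)
      define g :: "nat \<Rightarrow> ennreal" where "g k = ennreal ((real k + 1)\<^sup>2) * indicator (?A k) x" for k
      have "ennreal ((Y x)\<^sup>2) \<le> g k"
        unfolding g_def using k \<open>0 \<le> Y x\<close> x by (auto intro!: ennreal_leI power_mono)
      also have "\<dots> \<le> suminf g"
        using sum_le_suminf[OF summableI, of "{k}" g] by simp
      finally show ?thesis
        unfolding g_def[abs_def] .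
    qed
  qed
  also have "\<dots> = (\<Sum>k. ennreal ((real k + 1)\<^sup>2) * emeasure M (?A k))"
    by (subst nn_integral_suminf) (auto simp: nn_integral_cmult_indicator)
  also have "\<dots> \<le> (\<Sum>k. ennreal ((real k + 1)\<^sup>2 * exp (- real k / 2)))"
  proof (intro suminf_le summableI)
    fix k :: nat
    have "emeasure M (?A k) \<le> ennreal (exp (- real k / 2))"
      unfolding emeasure_eq_measure using tail[of "real k"] by (intro ennreal_leI) simp
    then show "ennreal ((real k + 1)\<^sup>2) * emeasure M (?A k) \<le> ennreal ((real k + 1)\<^sup>2 * exp (- real k / 2))"
      by (simp add: ennreal_mult mult_left_mono)
  qed
  also have "\<dots> = ennreal second_moment_bound"
    unfolding second_moment_bound_def by (intro suminf_ennreal2 summable_quadratic_exp) simp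
  finally show ?thesis .
qed

text \<open>Serves both the laws of \<open>V\<^sub>n\<close> and the limit law. The rate is 1/2
  rather than 1 because \<open>V\<^sub>n\<close> is scaled with \<open>n\<close> but built from
  \<open>n - 1\<close> observations, and \<open>(n - 1) / n \<ge> 1/2\<close> for
  \<open>n \<ge> 2\<close>.\<close>

locale exponential_tail = prob_space \<nu> for \<nu> :: "(real ^ 'd) measure" +
  assumes sets_eq[measurable_cong]: "sets \<nu> = sets borel"
    and AE_nonpos: "AE v in \<nu>. v \<le> 0"
    and tail: "\<And>i s. 0 \<le> s \<Longrightarrow> prob {v. v $ i \<le> - s} \<le> exp (- s / 2)"
begin

lemma space_eq: "space \<nu> = UNIV"
  using sets_eq_imp_space_eq[OF sets_eq] by simp

lemma nn_integral_norm_square_le: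
  "(\<integral>\<^sup>+v. ennreal ((norm v)\<^sup>2) \<partial>\<nu>) \<le> ennreal (CARD('d) * second_moment_bound)"
proof -
  have "(\<integral>\<^sup>+v. ennreal ((norm v)\<^sup>2) \<partial>\<nu>) = (\<integral>\<^sup>+v. (\<Sum>i\<in>UNIV. ennreal ((- v $ i)\<^sup>2)) \<partial>\<nu>)"
    by (simp add: norm_vec_def L2_set_def sum_nonneg)
  also have "\<dots> = (\<Sum>i\<in>UNIV. \<integral>\<^sup>+v. ennreal ((- v $ i)\<^sup>2) \<partial>\<nu>)"
    by (intro nn_integral_sum) auto
  also have "\<dots> \<le> (\<Sum>i\<in>(UNIV :: 'd set). ennreal second_moment_bound)"
  proof (intro sum_mono nn_integral_square_exponential_tail)
    show "AE v in \<nu>. 0 \<le> - v $ i" for i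
      using AE_nonpos by eventually_elim (auto simp: less_eq_vec_def)
    show "prob {v \<in> space \<nu>. s \<le> - v $ i} \<le> exp (- s / 2)" if "0 \<le> s" for i s
      using tail[OF that, of i] by (simp add: space_eq le_minus_iff)
  qed auto
  also have "\<dots> = ennreal (CARD('d) * second_moment_bound)"
    by (simp add: ennreal_mult second_moment_bound_nonneg ennreal_of_nat_eq_real_of_nat)
  finally show ?thesis .
qed

lemma integrable_norm_square: "integrable \<nu> (\<lambda>v. (norm v)\<^sup>2)"
  using nn_integral_norm_square_le by (intro integrableI_nonneg) (auto simp: le_less_trans)

lemma integral_norm_square_le: "(LINT v|\<nu>. (norm v)\<^sup>2) \<le> CARD('d) * second_moment_bound"
  using nn_integral_norm_square_le second_moment_bound_nonneg
  by (subst integral_eq_nn_integral) (auto intro!: enn2real_leI)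

text \<open>Linear growth is dominated by a multiple of \<open>1 + (norm v)\<^sup>2\<close>, whose
  integral is finite.\<close>

lemma integrable_lipschitz:
  assumes "c-lipschitz_on UNIV f"
  shows "integrable \<nu> (f :: _ \<Rightarrow> real)"
proof (rule Bochner_Integration.integrable_bound)
  show "integrable \<nu> (\<lambda>v. \<bar>f 0\<bar> + c * (1 + (norm v)\<^sup>2))"
    using integrable_norm_square by auto
  show "f \<in> borel_measurable \<nu>"
    using borel_measurable_continuous_onI[OF lipschitz_on_continuous_on[OF assms]]
    by (simp add: measurable_cong_sets[OF sets_eq refl])
  have "\<bar>f v\<bar> \<le> \<bar>f 0\<bar> + c * (1 + (norm v)\<^sup>2)" for v
  proof -
    have "\<bar>f v - f 0\<bar> \<le> c * norm v"
      using lipschitz_onD[OF assms, of v 0] by (simp add: dist_real_def)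
    moreover have "norm v \<le> 1 + (norm v)\<^sup>2"
      using sum_squares_bound[of "norm v" 1] by (simp add: power2_eq_square) (smt (verit) norm_ge_zero)
    then have "c * norm v \<le> c * (1 + (norm v)\<^sup>2)"
      by (intro mult_left_mono lipschitz_on_nonneg[OF assms])
    ultimately show ?thesis by linarith
  qed
  then show "AE v in \<nu>. norm (f v) \<le> norm (\<bar>f 0\<bar> + c * (1 + (norm v)\<^sup>2))"
    using lipschitz_on_nonneg[OF assms] by (auto intro!: AE_I2 order_trans[OF _ abs_ge_self])
qed

end

section \<open>Rounding to a grid\<close>

text \<open>Indices of the cells of side \<open>1/m\<close> that fill the vectors with all entries
  in \<open>(-m, 0]\<close>, hence \<open>m * m\<close> values per axis.\<close>

definition grid_indices :: "nat \<Rightarrow> ('d::finite \<Rightarrow> int) set" where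
  "grid_indices m = {k. \<forall>i. k i \<in> {- int (m * m)<..0}}"

definition grid_point :: "nat \<Rightarrow> ('d \<Rightarrow> int) \<Rightarrow> real ^ 'd" where
  "grid_point m k = (\<chi> i. real_of_int (k i) / real m)"

text \<open>The ceiling makes \<open>grid_point m k\<close> the upper corner of the cell and leaves
  the cell open below, a shape whose mass is determined by the distribution function.\<close>

definition grid_cell :: "nat \<Rightarrow> ('d \<Rightarrow> int) \<Rightarrow> (real ^ 'd) set" where
  "grid_cell m k = {v. \<forall>i. \<lceil>real m * v $ i\<rceil> = k i}"

lemma finite_grid_indices: "finite (grid_indices m :: ('d::finite \<Rightarrow> int) set)"
proof -
  have "grid_indices m = (PiE UNIV (\<lambda>_. {- int (m * m)<..0}) :: ('d \<Rightarrow> int) set)"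
    by (auto simp: grid_indices_def PiE_UNIV_domain)
  then show ?thesis by (simp add: finite_PiE)
qed

lemma grid_point_nonpos: "k \<in> grid_indices m \<Longrightarrow> grid_point m k \<le> 0"
  by (auto simp: grid_indices_def grid_point_def less_eq_vec_def divide_le_0_iff)

lemma grid_cell_eq_half_open_box:
  assumes "0 < m"
  shows "grid_cell m k = {v. v \<le> grid_point m k \<and> (\<forall>i. (grid_point m k - (\<chi> i. 1 / real m)) $ i < v $ i)}"
  using assms
  by (auto simp: grid_cell_def grid_point_def less_eq_vec_def ceiling_eq_iff field_simps)

text \<open>Inside the box \<open>(-m, 0]\<close> the function is rounded to a grid of mesh \<open>1/m\<close>; outside it
  \<open>norm v \<ge> m\<close>, so \<open>\<bar>f v\<bar> \<le> R + c * norm v\<close> is at most \<open>(R + c) * (norm v)\<^sup>2 / m\<close>.\<close>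

lemma (in exponential_tail) integral_grid_approx:
  fixes c R :: real
  assumes lip: "c-lipschitz_on UNIV f" and R: "\<bar>f 0\<bar> \<le> R" and m: "0 < m"
  shows "\<bar>(LINT v|\<nu>. f v) - (\<Sum>k\<in>grid_indices m. f (grid_point m k) * prob (grid_cell m k))\<bar>
    \<le> (c * CARD('d) + (R + c) * (CARD('d) * second_moment_bound)) / real m"
proof -
  define s where "s v = (\<Sum>k\<in>grid_indices m. f (grid_point m k) * indicator (grid_cell m k) v)" for v :: "real ^ 'd"
  have c: "0 \<le> c"
    by (rule lipschitz_on_nonneg[OF lip])
  have [measurable]: "grid_cell m k \<in> sets borel" for k :: "'d \<Rightarrow> int"
    unfolding grid_cell_def by measurable
  have s: "integrable \<nu> s"
    unfolding s_def
    by (intro Bochner_Integration.integrable_sum integrable_mult_right) (auto simp: emeasure_eq_measure)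
  have "(LINT v|\<nu>. s v) = (\<Sum>k\<in>grid_indices m. f (grid_point m k) * prob (grid_cell m k))"
    unfolding s_def
    by (subst Bochner_Integration.integral_sum) (auto simp: emeasure_eq_measure)
  then have "(LINT v|\<nu>. f v) - (\<Sum>k\<in>grid_indices m. f (grid_point m k) * prob (grid_cell m k))
      = (LINT v|\<nu>. f v - s v)"
    using s integrable_lipschitz[OF lip] by simp
  moreover have "norm (LINT v|\<nu>. f v - s v) \<le> (LINT v|\<nu>. c * CARD('d) / m + (R + c) / m * (norm v)\<^sup>2)"
  proof (rule order_trans[OF integral_norm_bound integral_mono_AE])
    show "integrable \<nu> (\<lambda>v. norm (f v - s v))"
      using s integrable_lipschitz[OF lip] by simp
    show "integrable \<nu> (\<lambda>v. c * CARD('d) / m + (R + c) / m * (norm v)\<^sup>2)"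
      using integrable_norm_square by simp
    have bound: "\<bar>f v - s v\<bar> \<le> c * CARD('d) / m + (R + c) / m * (norm v)\<^sup>2" if v: "v \<le> 0" for v
    proof -
      \<comment> \<open>The index of the one cell containing \<open>v\<close>, so at most one
        summand of \<open>s v\<close> survives.\<close>
      define k where "k i = \<lceil>real m * v $ i\<rceil>" for i
      have "v \<in> grid_cell m k' \<longleftrightarrow> k' = k" for k'
        by (auto simp: grid_cell_def k_def fun_eq_iff)
      then have "s v = (\<Sum>k'\<in>grid_indices m. if k' = k then f (grid_point m k) else 0)"
        unfolding s_def by (intro sum.cong) auto
      then have sv: "s v = (if k \<in> grid_indices m then f (grid_point m k) else 0)"
        by (simp add: finite_grid_indices)
      show ?thesis
      proof (cases "k \<in> grid_indices m")
        case True
        have "\<bar>(v - grid_point m k) $ i\<bar> \<le> 1 / m" for i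
        proof -
          have "(v - grid_point m k) $ i = (real m * v $ i - k i) / m"
            using m by (simp add: grid_point_def field_simps)
          moreover have "\<bar>real m * v $ i - k i\<bar> \<le> 1"
            unfolding k_def by linarith
          ultimately show ?thesis
            using m by (simp add: divide_right_mono)
        qed
        then have "norm (v - grid_point m k) \<le> (\<Sum>i\<in>(UNIV :: 'd set). 1 / m)"
          by (intro order_trans[OF norm_le_l1_cart] sum_mono)
        then have "c * norm (v - grid_point m k) \<le> c * (CARD('d) / m)"
          using c by (intro mult_left_mono) auto
        moreover have "\<bar>f v - f (grid_point m k)\<bar> \<le> c * norm (v - grid_point m k)"
          using lipschitz_onD[OF lip, of v "grid_point m k"] by (simp add: dist_real_def dist_norm)
        moreover have "0 \<le> (R + c) / m * (norm v)\<^sup>2"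
          using R c by auto
        ultimately show ?thesis
          using True sv by simp
      next
        case False
        then obtain j where "k j \<notin> {- int (m * m)<..0}"
          by (auto simp: grid_indices_def)
        moreover have "real m * v $ j \<le> 0"
          using v by (auto simp: less_eq_vec_def mult_le_0_iff)
        ultimately have "real m * v $ j \<le> - real (m * m)"
          unfolding k_def by (simp add: ceiling_le_iff not_less)
        then have "real m * v $ j \<le> real m * (- real m)"
          by simp
        then have "v $ j \<le> - real m"
          using m by (subst (asm) mult_le_cancel_left_pos) auto
        then have nv: "real m \<le> norm v"
          using component_le_norm_cart[of v j] by simp
        then have "real m * norm v \<le> (norm v)\<^sup>2" "real m * 1 \<le> norm v * norm v"
          using m unfolding power2_eq_square by (intro mult_right_mono mult_mono; simp)+
        then have "norm v \<le> (norm v)\<^sup>2 / m" "1 \<le> (norm v)\<^sup>2 / m"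
          using m by (auto simp: field_simps power2_eq_square)
        then have "c * norm v \<le> c * ((norm v)\<^sup>2 / m)" "R * 1 \<le> R * ((norm v)\<^sup>2 / m)"
          using c R by (intro mult_left_mono; simp)+
        moreover have "\<bar>f v\<bar> \<le> R + c * norm v"
          using lipschitz_onD[OF lip, of v 0] R by (simp add: dist_real_def)
        moreover have "(R + c) / m * (norm v)\<^sup>2 = R * ((norm v)\<^sup>2 / m) + c * ((norm v)\<^sup>2 / m)"
          by (simp add: add_divide_distrib distrib_right)
        moreover have "0 \<le> c * CARD('d) / m"
          using c by simp
        ultimately show ?thesis
          using False sv by simp
      qed
    qed
    show "AE v in \<nu>. norm (f v - s v) \<le> c * CARD('d) / m + (R + c) / m * (norm v)\<^sup>2"
      using AE_nonpos by eventually_elim (use bound in simp)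
  qed
  moreover have "(LINT v|\<nu>. c * CARD('d) / m + (R + c) / m * (norm v)\<^sup>2)
      = c * CARD('d) / m + (R + c) / m * (LINT v|\<nu>. (norm v)\<^sup>2)"
    using integrable_norm_square by (simp add: prob_space)
  moreover have "(R + c) / m * (LINT v|\<nu>. (norm v)\<^sup>2) \<le> (R + c) / m * (CARD('d) * second_moment_bound)"
    using R c by (intro mult_left_mono integral_norm_square_le) auto
  moreover have "c * CARD('d) / m + (R + c) / m * (CARD('d) * second_moment_bound)
      = (c * CARD('d) + (R + c) * (CARD('d) * second_moment_bound)) / real m"
    by (simp add: add_divide_distrib distrib_right)
  ultimately show ?thesis
    by simp
qed

text \<open>Laws and integrands both vary with \<open>n\<close>. On a fixed grid the approximating
  sums are finite and converge term by term; their error \<open>D / m\<close> is uniform in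
  \<open>n\<close>, since tails, Lipschitz constants and values at 0 are bounded uniformly. So
  \<open>m\<close> is chosen first and \<open>n\<close> afterwards.\<close>

lemma tendsto_integral_lipschitz:
  fixes \<nu> :: "nat \<Rightarrow> (real ^ 'd) measure" and \<rho> :: "(real ^ 'd) measure"
    and f :: "nat \<Rightarrow> real ^ 'd \<Rightarrow> real" and c :: real
  assumes \<nu>: "\<And>n. exponential_tail (\<nu> n)" and \<rho>: "exponential_tail \<rho>"
    and cdf: "\<And>v. v \<le> 0 \<Longrightarrow> (\<lambda>n. joint_cdf (\<nu> n) v) \<longlonglongrightarrow> joint_cdf \<rho> v"
    and lip: "\<And>n. c-lipschitz_on UNIV (f n)" "c-lipschitz_on UNIV g"
    and conv: "\<And>v. v \<le> 0 \<Longrightarrow> (\<lambda>n. f n v) \<longlonglongrightarrow> g v"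
  shows "(\<lambda>n. LINT v|\<nu> n. f n v) \<longlonglongrightarrow> (LINT v|\<rho>. g v)"
proof (rule LIMSEQ_I)
  fix e :: real assume "0 < e"
  have prob: "prob_space (\<nu> n)" "prob_space \<rho>" and sets: "sets (\<nu> n) = sets borel" "sets \<rho> = sets borel" for n
    using \<nu> \<rho> by (auto simp: exponential_tail_def exponential_tail_axioms_def)
  have "convergent (\<lambda>n. f n 0)"
    using conv[of 0] by (auto simp: convergent_def)
  then obtain R0 where R0: "\<And>n. \<bar>f n 0\<bar> \<le> R0"
    using convergent_imp_Bseq[of "\<lambda>n. f n 0"] by (auto simp: Bseq_def)
  define R where "R = max R0 \<bar>g 0\<bar>"
  have R: "\<bar>f n 0\<bar> \<le> R" "\<bar>g 0\<bar> \<le> R" for n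
    using R0[of n] by (auto simp: R_def)
  define D where "D = c * CARD('d) + (R + c) * (CARD('d) * second_moment_bound)"
  obtain m :: nat where m: "0 < m" "D / m < e / 3"
  proof -
    obtain m0 :: nat where "3 * \<bar>D\<bar> / e < m0"
      using reals_Archimedean2 by blast
    then have "\<bar>D\<bar> / Suc m0 < e / 3"
      using \<open>0 < e\<close> by (simp add: field_simps)
    then have "D / Suc m0 < e / 3"
      by (smt (verit) divide_right_mono of_nat_0_le_iff)
    then show ?thesis
      by (intro that[of "Suc m0"]) auto
  qed
  define S where "S \<sigma> h = (\<Sum>k\<in>grid_indices m. h (grid_point m k) * measure \<sigma> (grid_cell m k))"
    for \<sigma> and h :: "real ^ 'd \<Rightarrow> real"
  have "(\<lambda>n. S (\<nu> n) (f n)) \<longlonglongrightarrow> S \<rho> g"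
    unfolding S_def
  proof (intro tendsto_sum tendsto_mult)
    fix k :: "'d \<Rightarrow> int" assume k: "k \<in> grid_indices m"
    show "(\<lambda>n. f n (grid_point m k)) \<longlonglongrightarrow> g (grid_point m k)"
      using k by (intro conv grid_point_nonpos)
    show "(\<lambda>n. measure (\<nu> n) (grid_cell m k)) \<longlonglongrightarrow> measure \<rho> (grid_cell m k)"
      unfolding grid_cell_eq_half_open_box[OF m(1)]
      using k prob sets cdf
      by (intro tendsto_measure_half_open_box grid_point_nonpos) (auto simp: less_eq_vec_def)
  qed
  from LIMSEQ_D[OF this, of "e / 3"] \<open>0 < e\<close>
  obtain n0 where n0: "\<And>n. n \<ge> n0 \<Longrightarrow> \<bar>S (\<nu> n) (f n) - S \<rho> g\<bar> < e / 3"
    by auto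
  have approx: "\<bar>(LINT v|\<nu> n. f n v) - S (\<nu> n) (f n)\<bar> \<le> D / m" for n
    unfolding S_def D_def using exponential_tail.integral_grid_approx[OF \<nu> lip(1) R(1) m(1)] .
  have "\<bar>(LINT v|\<rho>. g v) - S \<rho> g\<bar> \<le> D / m"
    unfolding S_def D_def using exponential_tail.integral_grid_approx[OF \<rho> lip(2) R(2) m(1)] .
  then have "norm ((LINT v|\<nu> n. f n v) - (LINT v|\<rho>. g v)) < e" if "n \<ge> n0" for n
    using n0[OF that] approx[of n] m(2) unfolding real_norm_def by linarith
  then show "\<exists>n0. \<forall>n\<ge>n0. norm ((LINT v|\<nu> n. f n v) - (LINT v|\<rho>. g v)) < e"
    by blast
qed

section \<open>Samples with uniform margins\<close>

lemma borel_measurable_vec_lambda: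
  fixes f :: "'d::finite \<Rightarrow> 'a \<Rightarrow> real"
  assumes "\<And>i. f i \<in> borel_measurable M"
  shows "(\<lambda>x. \<chi> i. f i x) \<in> borel_measurable M"
  using assms by (subst borel_measurable_euclidean_space) (auto simp: Basis_vec_def inner_axis)

lemma pred_le_vec[measurable (raw)]:
  fixes f g :: "'a \<Rightarrow> real ^ 'd"
  assumes "f \<in> borel_measurable M" "g \<in> borel_measurable M"
  shows "Measurable.pred M (\<lambda>x. f x \<le> g x)"
proof -
  have "(\<lambda>x. f x $ i) \<in> borel_measurable M" "(\<lambda>x. g x $ i) \<in> borel_measurable M" for i
    using assms by (auto intro: measurable_compose[of _ M borel "\<lambda>v. v $ i"])
  note [measurable] = this
  show ?thesis
    unfolding less_eq_vec_def by measurable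
qed

lemma measurable_inf_vec[measurable (raw)]:
  fixes f g :: "'a \<Rightarrow> real ^ 'd"
  assumes "f \<in> borel_measurable M" "g \<in> borel_measurable M"
  shows "(\<lambda>x. inf (f x) (g x)) \<in> borel_measurable M"
proof -
  have "(\<lambda>x. f x $ i) \<in> borel_measurable M" "(\<lambda>x. g x $ i) \<in> borel_measurable M" for i
    using assms by (auto intro: measurable_compose[of _ M borel "\<lambda>v. v $ i"])
  then show ?thesis
    unfolding inf_vec_def inf_real_def by (intro borel_measurable_vec_lambda borel_measurable_min)
qed

text \<open>Taking logarithms, \<open>n * ln (c n)\<close> tends to \<open>- L\<close>, so
  \<open>c n\<close> tends to 1. The inequalities
  \<open>c * (- ln c) \<le> 1 - c \<le> - ln c\<close>, multiplied by \<open>n\<close>, then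
  sandwich the sequence.\<close>

lemma tendsto_mult_one_minus_of_power:
  fixes c :: "nat \<Rightarrow> real"
  assumes c: "\<And>n. 0 \<le> c n" "\<And>n. c n \<le> 1" and lim: "(\<lambda>n. c n ^ n) \<longlonglongrightarrow> exp (- L)"
  shows "(\<lambda>n. real n * (1 - c n)) \<longlonglongrightarrow> L"
proof -
  have "eventually (\<lambda>n. 0 < c n ^ n) sequentially"
    using lim by (rule order_tendstoD) simp
  \<comment> \<open>The index 0 is excluded because \<open>c 0 ^ 0 = 1\<close> says nothing about
    \<open>c 0\<close>.\<close>
  then have pos: "eventually (\<lambda>n. 0 < c n) sequentially"
    using eventually_gt_at_top[of 0]
  proof eventually_elim
    case (elim n)
    then have "c n \<noteq> 0"
      by (auto simp: zero_power)
    with c(1)[of n] show ?case by simp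
  qed
  have "(\<lambda>n. ln (c n ^ n)) \<longlonglongrightarrow> ln (exp (- L))"
    using lim by (rule tendsto_ln) simp
  then have "(\<lambda>n. ln (c n ^ n)) \<longlonglongrightarrow> - L"
    by simp
  moreover have "eventually (\<lambda>n. ln (c n ^ n) = real n * ln (c n)) sequentially"
    using pos by eventually_elim (simp add: ln_realpow)
  ultimately have nln: "(\<lambda>n. real n * ln (c n)) \<longlonglongrightarrow> - L"
    by (rule Lim_transform_eventually)
  have "(\<lambda>n. inverse (real n) * (real n * ln (c n))) \<longlonglongrightarrow> 0 * (- L)"
    by (intro tendsto_mult nln lim_inverse_n)
  from tendsto_exp[OF this] have "(\<lambda>n. exp (inverse (real n) * (real n * ln (c n)))) \<longlonglongrightarrow> 1"
    by simp
  moreover have "eventually (\<lambda>n. exp (inverse (real n) * (real n * ln (c n))) = c n) sequentially"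
    using pos eventually_gt_at_top[of 0] by eventually_elim (simp add: mult.assoc[symmetric])
  ultimately have c1: "c \<longlonglongrightarrow> 1"
    by (rule Lim_transform_eventually)
  show ?thesis
  proof (rule tendsto_sandwich)
    show "(\<lambda>n. c n * (- (real n * ln (c n)))) \<longlonglongrightarrow> L"
      using tendsto_mult[OF c1 tendsto_minus[OF nln]] by simp
    show "(\<lambda>n. - (real n * ln (c n))) \<longlonglongrightarrow> L"
      using tendsto_minus[OF nln] by simp
    show "eventually (\<lambda>n. c n * (- (real n * ln (c n))) \<le> real n * (1 - c n)) sequentially"
      using pos
    proof eventually_elim
      case (elim n)
      have "- ln (c n) \<le> 1 / c n - 1"
        using ln_le_minus_one[of "1 / c n"] elim by (simp add: ln_div)
      then have "c n * (- ln (c n)) \<le> c n * (1 / c n - 1)"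
        using elim by (intro mult_left_mono) auto
      then have "real n * (c n * (- ln (c n))) \<le> real n * (1 - c n)"
        using elim by (intro mult_left_mono) (auto simp: right_diff_distrib)
      then show ?case
        by (simp add: mult_ac)
    qed
    show "eventually (\<lambda>n. real n * (1 - c n) \<le> - (real n * ln (c n))) sequentially"
      using pos
    proof eventually_elim
      case (elim n)
      have "real n * (1 - c n) \<le> real n * (- ln (c n))"
        using ln_le_minus_one[OF elim] by (intro mult_left_mono) auto
      then show ?case by simp
    qed
  qed
qed

section \<open>Copula laws near the upper corner of the cube\<close>

text \<open>A copula encoded as a law rather than as a function on the cube:
  \<open>joint_cdf \<kappa>\<close> is defined on the whole space, so \<open>1 + v / n\<close> is a
  meaningful argument for every \<open>v\<close>.\<close>

locale copula_law = prob_space \<kappa> for \<kappa> :: "(real ^ 'd) measure" +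
  assumes sets_eq[measurable_cong]: "sets \<kappa> = sets borel"
    and uniform_margin: "\<And>i s. 0 \<le> s \<Longrightarrow> s \<le> 1 \<Longrightarrow> prob {u. u $ i \<le> s} = s"
begin

lemma space_eq: "space \<kappa> = UNIV"
  using sets_eq_imp_space_eq[OF sets_eq] by simp

lemma prob_margin: "prob {u. u $ i \<le> s} = max 0 (min 1 s)"
proof -
  consider "s < 0" | "0 \<le> s" "s \<le> 1" | "1 < s" by linarith
  then show ?thesis
  proof cases
    case 1
    then have "prob {u. u $ i \<le> s} \<le> prob {u. u $ i \<le> 0}"
      by (intro finite_measure_mono) auto
    with 1 show ?thesis using uniform_margin[of 0 i] by (simp add: measure_le_0_iff)
  next
    case 3
    then have "prob {u. u $ i \<le> 1} \<le> prob {u. u $ i \<le> s}"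
      by (intro finite_measure_mono) auto
    with 3 show ?thesis using uniform_margin[of 1 i] prob_le_1[of "{u. u $ i \<le> s}"] by simp
  qed (simp add: uniform_margin)
qed

lemma AE_le_1: "AE u in \<kappa>. u \<le> 1"
proof -
  have "AE u in \<kappa>. u $ i \<le> 1" for i
    using prob_margin[of i 1] by (subst prob_Collect_eq_1[symmetric]) (auto simp: space_eq)
  then have "AE u in \<kappa>. \<forall>i. u $ i \<le> 1"
    by (simp add: AE_all_countable)
  then show ?thesis
    by (simp add: less_eq_vec_def)
qed

lemma joint_cdf_1: "joint_cdf \<kappa> 1 = 1"
  using AE_le_1 unfolding joint_cdf_def by (subst prob_eq_1) auto

text \<open>A point below \<open>u\<close> but not below \<open>w\<close> lies, for some
  \<open>i\<close>, in the strip between \<open>w $ i\<close> and \<open>u $ i\<close>, whose mass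
  the uniform margin bounds by its width.\<close>

lemma joint_cdf_diff_le: "joint_cdf \<kappa> u - joint_cdf \<kappa> w \<le> CARD('d) * norm (u - w)"
proof -
  have "joint_cdf \<kappa> u \<le> prob ({..w} \<union> (\<Union>i. {v. v $ i \<le> u $ i} - {v. v $ i \<le> w $ i}))"
    unfolding joint_cdf_def by (intro finite_measure_mono) (auto simp: less_eq_vec_def)
  also have "\<dots> \<le> joint_cdf \<kappa> w + prob (\<Union>i. {v. v $ i \<le> u $ i} - {v. v $ i \<le> w $ i})"
    unfolding joint_cdf_def by (intro measure_Un_le) auto
  also have "prob (\<Union>i. {v. v $ i \<le> u $ i} - {v. v $ i \<le> w $ i})
      \<le> (\<Sum>i\<in>UNIV. prob ({v. v $ i \<le> u $ i} - {v. v $ i \<le> w $ i}))"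
    by (intro finite_measure_subadditive_finite) auto
  also have "\<dots> \<le> (\<Sum>i\<in>(UNIV :: 'd set). norm (u - w))"
  proof (rule sum_mono)
    fix i
    show "prob ({v. v $ i \<le> u $ i} - {v. v $ i \<le> w $ i}) \<le> norm (u - w)"
    proof (cases "w $ i \<le> u $ i")
      case True
      then have "{v. v $ i \<le> w $ i} \<subseteq> {v. v $ i \<le> u $ i}"
        by auto
      then have "prob ({v. v $ i \<le> u $ i} - {v. v $ i \<le> w $ i}) = max 0 (min 1 (u $ i)) - max 0 (min 1 (w $ i))"
        by (subst finite_measure_Diff) (auto simp: prob_margin)
      also have "\<dots> \<le> \<bar>(u - w) $ i\<bar>"
        by simp
      finally show ?thesis
        using component_le_norm_cart[of "u - w" i] by linarith
    next
      case False
      then have eq: "{v. v $ i \<le> u $ i} - {v. v $ i \<le> w $ i} = {}"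
        by auto
      show ?thesis
        unfolding eq by simp
    qed
  qed
  finally show ?thesis by simp
qed

text \<open>This is \<open>g\<^sub>n\<close> of the overview; for \<open>n = 0\<close> it is
  constantly 0.\<close>

definition rescaled :: "nat \<Rightarrow> real ^ 'd \<Rightarrow> real" where
  "rescaled n v = real n * (1 - joint_cdf \<kappa> (1 + v /\<^sub>R real n))"

lemma rescaled_0: "rescaled n 0 = 0"
  by (simp add: rescaled_def joint_cdf_1)

text \<open>The factor \<open>n\<close> cancels against the contraction by \<open>1 / n\<close>, so
  the constant does not depend on \<open>n\<close>.\<close>

lemma rescaled_lipschitz: "CARD('d)-lipschitz_on UNIV (rescaled n)"
proof (rule lipschitz_onI)
  have le: "rescaled n v - rescaled n w \<le> CARD('d) * norm (v - w)" for v w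
  proof (cases "n = 0")
    case False
    have "rescaled n v - rescaled n w
        = n * (joint_cdf \<kappa> (1 + w /\<^sub>R real n) - joint_cdf \<kappa> (1 + v /\<^sub>R real n))"
      by (simp add: rescaled_def algebra_simps)
    also have "\<dots> \<le> n * (CARD('d) * norm ((1 + w /\<^sub>R real n) - (1 + v /\<^sub>R real n)))"
      by (intro mult_left_mono joint_cdf_diff_le) simp
    also have "(1 + w /\<^sub>R real n) - (1 + v /\<^sub>R real n) = (w - v) /\<^sub>R real n"
      by (simp add: scaleR_diff_right)
    also have "n * (CARD('d) * norm \<dots>) = CARD('d) * norm (v - w)"
      using False unfolding norm_scaleR by (simp add: norm_minus_commute)
    finally show ?thesis .
  qed (simp add: rescaled_def)
  show "dist (rescaled n v) (rescaled n w) \<le> CARD('d) * dist v w" for v w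
    using le[of v w] le[of w v] by (simp add: dist_real_def dist_norm norm_minus_commute)
qed simp

text \<open>A joint distribution function is at most each of its margins, and the margin is explicit
  once \<open>1 + v $ i / n\<close> lies in the unit interval.\<close>

lemma minus_component_le_rescaled:
  assumes "0 < n" "v $ i \<le> 0" "- real n \<le> v $ i"
  shows "- v $ i \<le> rescaled n v"
proof -
  have "joint_cdf \<kappa> (1 + v /\<^sub>R real n) \<le> prob {u. u $ i \<le> 1 + v $ i / n}"
    unfolding joint_cdf_def
    by (intro finite_measure_mono) (auto simp: less_eq_vec_def field_simps dest: spec[of _ i])
  also have "\<dots> = 1 + v $ i / n"
    using assms by (subst uniform_margin) (auto simp: field_simps)
  finally have "real n * (1 - (1 + v $ i / n)) \<le> rescaled n v"
    unfolding rescaled_def by (intro mult_left_mono) auto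
  with assms show ?thesis by simp
qed

end

section \<open>Attraction to the D-norm\<close>

text \<open>\<open>attraction\<close> determines \<open>N\<close> on the nonpositive orthant;
  \<open>N_abs\<close> transports what is obtained there to all vectors.\<close>

locale attracted_copula = copula_law \<kappa> for \<kappa> :: "(real ^ 'd) measure" +
  fixes N :: "real ^ 'd \<Rightarrow> real"
  assumes attraction: "\<And>v. v \<le> 0 \<Longrightarrow> (\<lambda>n. joint_cdf \<kappa> (1 + v /\<^sub>R real n) ^ n) \<longlonglongrightarrow> exp (- N v)"
    and N_abs: "\<And>v. N v = N (- (\<chi> i. \<bar>v $ i\<bar>))"
begin

lemma tendsto_rescaled: "v \<le> 0 \<Longrightarrow> (\<lambda>n. rescaled n v) \<longlonglongrightarrow> N v"
  unfolding rescaled_def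
  by (intro tendsto_mult_one_minus_of_power attraction) (auto simp: joint_cdf_def)

text \<open>Equi-Lipschitz continuity absorbs the moving argument, which is needed because the
  rescaled thresholds vary with \<open>n\<close>.\<close>

lemma tendsto_rescaled_seq:
  assumes u: "u \<longlonglongrightarrow> v" and v: "v \<le> 0"
  shows "(\<lambda>n. rescaled n (u n)) \<longlonglongrightarrow> N v"
proof -
  have "(\<lambda>n. rescaled n (u n) - rescaled n v) \<longlonglongrightarrow> 0"
  proof (rule Lim_null_comparison)
    show "\<forall>\<^sub>F n in sequentially. norm (rescaled n (u n) - rescaled n v) \<le> CARD('d) * norm (u n - v)"
      using lipschitz_onD[OF rescaled_lipschitz] by (simp add: dist_norm)
    show "(\<lambda>n. CARD('d) * norm (u n - v)) \<longlonglongrightarrow> 0"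
      by (intro tendsto_mult_right_zero tendsto_norm_zero LIM_zero u)
  qed
  from tendsto_add[OF this tendsto_rescaled[OF v]] show ?thesis
    by simp
qed

lemma N_0: "N 0 = 0"
  using LIMSEQ_unique[OF tendsto_rescaled[of 0]] by (simp add: rescaled_0)

text \<open>Limit of the bound for \<open>rescaled\<close>. It yields the tail of the limit law and
  the positivity of the mean of \<open>N\<close>.\<close>

lemma minus_component_le_N:
  assumes "v \<le> 0"
  shows "- v $ i \<le> N v"
proof (rule tendsto_lowerbound[OF tendsto_rescaled[OF assms]])
  obtain n0 :: nat where "- v $ i \<le> n0"
    using real_arch_simple by blast
  then show "\<forall>\<^sub>F n in sequentially. - v $ i \<le> rescaled n v"
    using assms
    by (intro eventually_sequentiallyI[of "Suc n0"] minus_component_le_rescaled) (auto simp: less_eq_vec_def)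
qed simp

text \<open>On the nonpositive orthant \<open>N\<close> is a pointwise limit of functions with a
  common Lipschitz constant. The map \<open>?m\<close> sends every vector there without changing
  \<open>N\<close> and without increasing distances.\<close>

lemma N_lipschitz: "CARD('d)-lipschitz_on UNIV N"
proof (rule lipschitz_onI)
  fix v w :: "real ^ 'd"
  let ?m = "\<lambda>v :: real ^ 'd. - (\<chi> i. \<bar>v $ i\<bar>)"
  have m: "?m v \<le> 0" for v
    by (simp add: less_eq_vec_def)
  have "dist (N (?m v)) (N (?m w)) \<le> CARD('d) * dist (?m v) (?m w)"
  proof (rule tendsto_upperbound)
    show "(\<lambda>n. dist (rescaled n (?m v)) (rescaled n (?m w))) \<longlonglongrightarrow> dist (N (?m v)) (N (?m w))"
      by (intro tendsto_dist tendsto_rescaled m)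
    show "\<forall>\<^sub>F n in sequentially. dist (rescaled n (?m v)) (rescaled n (?m w)) \<le> CARD('d) * dist (?m v) (?m w)"
      using lipschitz_onD[OF rescaled_lipschitz] by auto
  qed simp
  also have "dist (?m v) (?m w) \<le> dist v w"
    unfolding dist_norm by (intro norm_le_componentwise_cart) auto
  finally show "dist (N v) (N w) \<le> CARD('d) * dist v w"
    using N_abs[of v] N_abs[of w] by (simp add: mult_left_mono)
qed simp

text \<open>The exponent is \<open>n - 1\<close> since only earlier observations enter the maximum,
  while the scaling uses \<open>n\<close>. The base tends to 1, as \<open>rescaled n v\<close>
  converges, so one factor less does not change the limit.\<close>

lemma tendsto_joint_cdf_power_pred:
  assumes "v \<le> 0"
  shows "(\<lambda>n. joint_cdf \<kappa> (1 + v /\<^sub>R real n) ^ (n - 1)) \<longlonglongrightarrow> exp (- N v)"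
proof -
  let ?K = "\<lambda>n. joint_cdf \<kappa> (1 + v /\<^sub>R real n)"
  have "(\<lambda>n. inverse (real n) * rescaled n v) \<longlonglongrightarrow> 0 * N v"
    by (intro tendsto_mult lim_inverse_n tendsto_rescaled assms)
  from tendsto_diff[OF tendsto_const[of 1] this]
  have "(\<lambda>n. 1 - inverse (real n) * rescaled n v) \<longlonglongrightarrow> 1"
    by simp
  moreover have "\<forall>\<^sub>F n in sequentially. 1 - inverse (real n) * rescaled n v = ?K n"
    using eventually_gt_at_top[of 0] by eventually_elim (simp add: rescaled_def mult.assoc[symmetric])
  ultimately have K: "?K \<longlonglongrightarrow> 1"
    by (rule Lim_transform_eventually)
  have "(\<lambda>n. ?K n ^ n / ?K n) \<longlonglongrightarrow> exp (- N v) / 1"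
    by (intro tendsto_divide attraction assms K) simp
  moreover have "\<forall>\<^sub>F n in sequentially. ?K n ^ n / ?K n = ?K n ^ (n - 1)"
    using order_tendstoD(1)[OF K zero_less_one] eventually_gt_at_top[of 0]
    by eventually_elim (simp add: power_diff)
  ultimately show ?thesis
    by (auto intro: Lim_transform_eventually)
qed

end

section \<open>The sample and its past maximum\<close>

locale iid_copula_sample = M: prob_space M + copula_law \<kappa>
  for M :: "'a measure" and \<kappa> :: "(real ^ 'd) measure" +
  fixes U :: "nat \<Rightarrow> 'a \<Rightarrow> real ^ 'd"
  assumes indep: "M.indep_vars (\<lambda>_. borel) U {1..}"
    and distr_U: "\<And>n. 1 \<le> n \<Longrightarrow> distr M borel (U n) = \<kappa>"
begin

lemma measurable_U: "1 \<le> n \<Longrightarrow> U n \<in> borel_measurable M"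
  using indep by (auto simp: M.indep_vars_def)

text \<open>For \<open>n \<le> 1\<close> the maximum is over the empty set and has no specified
  value, so the facts about it assume \<open>2 \<le> n\<close>.\<close>

definition previous_max :: "nat \<Rightarrow> 'a \<Rightarrow> real ^ 'd" where
  "previous_max n \<omega> = (\<chi> i. MAX k\<in>{1..<n}. U k \<omega> $ i)"

lemma previous_max_component_le_iff:
  "2 \<le> n \<Longrightarrow> previous_max n \<omega> $ i \<le> t \<longleftrightarrow> (\<forall>k\<in>{1..<n}. U k \<omega> $ i \<le> t)"
  by (subst previous_max_def) auto

lemma previous_max_le_iff:
  "2 \<le> n \<Longrightarrow> previous_max n \<omega> \<le> w \<longleftrightarrow> (\<forall>k\<in>{1..<n}. U k \<omega> \<le> w)"
  unfolding less_eq_vec_def previous_max_component_le_iff by blast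

text \<open>The two vectors are functions of the disjoint blocks \<open>{n}\<close> and
  \<open>{1..<n}\<close> of the sample.\<close>

lemma indep_var_previous_max:
  assumes "2 \<le> n"
  shows "M.indep_var borel (U n) borel (previous_max n)"
proof -
  have "M.indep_vars (\<lambda>_. borel) U (insert n {1..<n})"
    using assms by (intro M.indep_vars_subset[OF indep]) auto
  then have "M.indep_var
      borel ((\<lambda>f. f n) \<circ> (\<lambda>\<omega>. restrict (\<lambda>i. U i \<omega>) {n}))
      borel ((\<lambda>f. \<chi> i. MAX k\<in>{1..<n}. f k $ i) \<circ> (\<lambda>\<omega>. restrict (\<lambda>i. U i \<omega>) {1..<n}))"
    by (intro M.indep_var_compose[OF M.indep_var_restrict] borel_measurable_vec_lambda borel_measurable_Max
          measurable_compose[of "\<lambda>f. f _" _ borel "\<lambda>u. u $ _"]) auto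
  also have "(\<lambda>f. f n) \<circ> (\<lambda>\<omega>. restrict (\<lambda>i. U i \<omega>) {n}) = U n"
    by auto
  also have "(\<lambda>f. \<chi> i. MAX k\<in>{1..<n}. f k $ i) \<circ> (\<lambda>\<omega>. restrict (\<lambda>i. U i \<omega>) {1..<n}) = previous_max n"
    by (auto simp: previous_max_def fun_eq_iff cong: rev_conj_cong)
  finally show ?thesis .
qed

lemma measurable_previous_max: "2 \<le> n \<Longrightarrow> previous_max n \<in> borel_measurable M"
  using indep_var_previous_max M.indep_var_rv2 by blast

lemma prob_all_previous:
  assumes "2 \<le> n" and A: "A \<in> sets borel"
  shows "M.prob {\<omega> \<in> space M. \<forall>k\<in>{1..<n}. U k \<omega> \<in> A} = prob A ^ (n - 1)"
proof -
  have "M.prob (\<Inter>k\<in>{1..<n}. U k -` A \<inter> space M) = (\<Prod>k\<in>{1..<n}. M.prob (U k -` A \<inter> space M))"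
    using assms by (intro M.indep_varsD[OF indep]) auto
  also have "\<dots> = (\<Prod>k\<in>{1..<n}. prob A)"
    using measure_distr[OF measurable_U A] distr_U by (intro prod.cong) auto
  also have "(\<Inter>k\<in>{1..<n}. U k -` A \<inter> space M) = {\<omega> \<in> space M. \<forall>k\<in>{1..<n}. U k \<omega> \<in> A}"
    using assms by auto
  finally show ?thesis by simp
qed

text \<open>The law of \<open>V\<^sub>n\<close> of the overview.\<close>

definition max_law :: "nat \<Rightarrow> (real ^ 'd) measure" where
  "max_law n = distr M borel (\<lambda>\<omega>. real n *\<^sub>R (previous_max n \<omega> - 1))"

lemma measurable_rescaled_max:
  "2 \<le> n \<Longrightarrow> (\<lambda>\<omega>. real n *\<^sub>R (previous_max n \<omega> - 1)) \<in> borel_measurable M"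
  using measurable_previous_max[of n] by measurable

lemma joint_cdf_max_law:
  assumes "2 \<le> n"
  shows "joint_cdf (max_law n) v = joint_cdf \<kappa> (1 + v /\<^sub>R real n) ^ (n - 1)"
proof -
  have "(real n *\<^sub>R (w - 1) \<le> v) \<longleftrightarrow> w \<le> 1 + v /\<^sub>R real n" for w :: "real ^ 'd"
    using assms by (auto simp: less_eq_vec_def field_simps)
  then have "joint_cdf (max_law n) v = M.prob {\<omega> \<in> space M. previous_max n \<omega> \<le> 1 + v /\<^sub>R real n}"
    unfolding joint_cdf_def max_law_def
    by (subst measure_distr[OF measurable_rescaled_max[OF assms]])
       (auto intro!: arg_cong[where f = M.prob])
  also have "\<dots> = joint_cdf \<kappa> (1 + v /\<^sub>R real n) ^ (n - 1)"
    using prob_all_previous[OF assms, of "{..1 + v /\<^sub>R real n}"] assms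
    by (simp add: previous_max_le_iff joint_cdf_def)
  finally show ?thesis .
qed

text \<open>Nonpositivity holds because the joint distribution function is 1 at 0. The tail is a
  power of a single uniform margin, bounded through \<open>1 - z \<le> exp (- z)\<close>.\<close>

lemma exponential_tail_max_law:
  assumes "2 \<le> n"
  shows "exponential_tail (max_law n)"
proof (intro exponential_tail.intro exponential_tail_axioms.intro)
  note meas[measurable] = measurable_rescaled_max[OF assms]
  show prob: "prob_space (max_law n)"
    unfolding max_law_def by (intro M.prob_space_distr meas)
  show sets: "sets (max_law n) = sets borel"
    by (simp add: max_law_def)
  interpret L: prob_space "max_law n" by fact
  have "L.prob {..0} = 1"
    using joint_cdf_max_law[OF assms, of 0] by (simp add: joint_cdf_1) (simp add: joint_cdf_def)
  then have "AE v in max_law n. v \<in> {..0}"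
    by (subst (asm) L.prob_eq_1) (auto simp: sets)
  then show "AE v in max_law n. v \<le> 0"
    by simp
  fix i and s :: real assume s: "0 \<le> s"
  let ?t = "1 - s / n"
  have "n * (w - 1) \<le> - s \<longleftrightarrow> w \<le> ?t" for w :: real
    using assms by (auto simp: field_simps)
  then have "L.prob {v. v $ i \<le> - s} = M.prob {\<omega> \<in> space M. previous_max n \<omega> $ i \<le> ?t}"
    unfolding max_law_def
    by (subst measure_distr[OF meas]) (auto intro!: arg_cong[where f = M.prob])
  also have "\<dots> = (max 0 (min 1 ?t)) ^ (n - 1)"
    using prob_all_previous[OF assms, of "{u. u $ i \<le> ?t}"]
    by (simp add: previous_max_component_le_iff[OF assms] prob_margin)
  also have "\<dots> \<le> exp (- (s / n)) ^ (n - 1)"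
    using exp_ge_add_one_self[of "- (s / n)"] s by (intro power_mono) auto
  also have "\<dots> = exp (- (s * ((n - 1) / n)))"
    by (simp add: exp_of_nat_mult[symmetric] mult_ac)
  also have "\<dots> \<le> exp (- s / 2)"
  proof -
    have "s * (1 / 2) \<le> s * ((n - 1) / n)"
      using assms s by (intro mult_left_mono) (auto simp: field_simps of_nat_diff)
    then show ?thesis by simp
  qed
  finally show "L.prob {v. v $ i \<le> - s} \<le> exp (- s / 2)" .
qed

text \<open>The event is that \<open>U n\<close> is below \<open>?t\<close>, minus that it is below
  both \<open>?t\<close> and the past maximum. By independence and Fubini the latter has probability
  the mean of \<open>joint_cdf \<kappa>\<close> at the minimum of the two; passing to complements
  and multiplying by \<open>n\<close> gives \<open>rescaled\<close>.\<close>

lemma prob_below_and_record: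
  assumes n: "2 \<le> n"
  shows "real n * M.prob {\<omega> \<in> space M. U n \<omega> \<le> 1 + y /\<^sub>R real n \<and> \<not> U n \<omega> \<le> previous_max n \<omega>}
    = (LINT v|max_law n. rescaled n (inf y v)) - rescaled n y"
proof -
  let ?t = "1 + y /\<^sub>R real n" and ?W = "previous_max n"
  have [measurable]: "U n \<in> borel_measurable M" "?W \<in> borel_measurable M"
    using measurable_U[of n] measurable_previous_max[OF n] n by auto
  interpret W: prob_space "distr M borel ?W"
    by (intro M.prob_space_distr) simp
  interpret P: pair_prob_space \<kappa> "distr M borel ?W" ..
  \<comment> \<open>The section at a fixed second component \<open>w\<close> is the orthant below
    \<open>inf ?t w\<close>.\<close>
  define A where "A = {p :: (real ^ 'd) \<times> (real ^ 'd). fst p \<le> inf ?t (snd p)}"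
  have "A = {p \<in> space (borel \<Otimes>\<^sub>M borel). fst p \<le> inf ?t (snd p)}"
    by (simp add: A_def space_pair_measure)
  also have "\<dots> \<in> sets (borel \<Otimes>\<^sub>M borel)"
    by measurable
  finally have A: "A \<in> sets (borel \<Otimes>\<^sub>M borel)" .
  have meas_K: "joint_cdf \<kappa> \<in> borel_measurable borel"
  proof (rule borel_measurable_continuous_onI, rule lipschitz_on_continuous_on, rule lipschitz_onI)
    show "dist (joint_cdf \<kappa> u) (joint_cdf \<kappa> w) \<le> CARD('d) * dist u w" for u w
      using joint_cdf_diff_le[of u w] joint_cdf_diff_le[of w u]
      by (simp add: dist_real_def dist_norm norm_minus_commute)
  qed simp
  note [measurable] = meas_K
  have int: "integrable M (\<lambda>\<omega>. joint_cdf \<kappa> (inf ?t (?W \<omega>)))"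
  proof (rule M.integrable_const_bound[of _ 1])
    show "AE \<omega> in M. norm (joint_cdf \<kappa> (inf ?t (?W \<omega>))) \<le> 1"
      by (simp add: joint_cdf_def prob_le_1)
  qed measurable
  have "M.prob {\<omega> \<in> space M. U n \<omega> \<le> inf ?t (?W \<omega>)}
      = measure (distr M (borel \<Otimes>\<^sub>M borel) (\<lambda>\<omega>. (U n \<omega>, ?W \<omega>))) A"
  proof -
    have "(\<lambda>\<omega>. (U n \<omega>, ?W \<omega>)) \<in> M \<rightarrow>\<^sub>M borel \<Otimes>\<^sub>M borel"
      by measurable
    from measure_distr[OF this A] show ?thesis
      by (simp add: A_def vimage_def Int_def conj_commute)
  qed
  also have "distr M (borel \<Otimes>\<^sub>M borel) (\<lambda>\<omega>. (U n \<omega>, ?W \<omega>)) = \<kappa> \<Otimes>\<^sub>M distr M borel ?W"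
    using indep_var_previous_max[OF n] distr_U[of n] n by (simp add: M.indep_var_distribution_eq)
  also have "measure (\<kappa> \<Otimes>\<^sub>M distr M borel ?W) A
      = (LINT w|distr M borel ?W. joint_cdf \<kappa> (inf ?t w))"
  proof -
    have "emeasure (\<kappa> \<Otimes>\<^sub>M distr M borel ?W) A
        = (\<integral>\<^sup>+w. ennreal (joint_cdf \<kappa> (inf ?t w)) \<partial>distr M borel ?W)"
    proof (subst P.emeasure_pair_measure_alt2)
      show "A \<in> sets (\<kappa> \<Otimes>\<^sub>M distr M borel ?W)"
        using A by simp
      have "(\<lambda>u. (u, w)) -` A = {..inf ?t w}" for w
        unfolding A_def by auto
      then show "(\<integral>\<^sup>+w. emeasure \<kappa> ((\<lambda>u. (u, w)) -` A) \<partial>distr M borel ?W)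
          = (\<integral>\<^sup>+w. ennreal (joint_cdf \<kappa> (inf ?t w)) \<partial>distr M borel ?W)"
        by (simp only: joint_cdf_def emeasure_eq_measure)
    qed
    moreover have "(\<lambda>w. joint_cdf \<kappa> (inf ?t w)) \<in> borel_measurable (distr M borel ?W)"
      by measurable
    moreover have "0 \<le> joint_cdf \<kappa> u" for u
      by (simp add: joint_cdf_def)
    ultimately show ?thesis
      by (simp add: measure_def integral_eq_nn_integral)
  qed
  also have "\<dots> = (LINT \<omega>|M. joint_cdf \<kappa> (inf ?t (?W \<omega>)))"
    by (intro integral_distr) auto
  finally have inf_eq: "M.prob {\<omega> \<in> space M. U n \<omega> \<le> inf ?t (?W \<omega>)}
      = (LINT \<omega>|M. joint_cdf \<kappa> (inf ?t (?W \<omega>)))" .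
  have "M.prob {\<omega> \<in> space M. U n \<omega> \<le> ?t} = joint_cdf \<kappa> ?t"
    using measure_distr[of "U n" M borel "{..?t}"] distr_U[of n] n
    by (simp add: joint_cdf_def vimage_def Int_def conj_commute)
  moreover have "{\<omega> \<in> space M. U n \<omega> \<le> ?t \<and> \<not> U n \<omega> \<le> ?W \<omega>}
      = {\<omega> \<in> space M. U n \<omega> \<le> ?t} - {\<omega> \<in> space M. U n \<omega> \<le> inf ?t (?W \<omega>)}"
    by auto
  then have "M.prob {\<omega> \<in> space M. U n \<omega> \<le> ?t \<and> \<not> U n \<omega> \<le> ?W \<omega>}
      = M.prob {\<omega> \<in> space M. U n \<omega> \<le> ?t} - M.prob {\<omega> \<in> space M. U n \<omega> \<le> inf ?t (?W \<omega>)}"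
    by (simp only:, subst M.finite_measure_Diff) auto
  ultimately have "M.prob {\<omega> \<in> space M. U n \<omega> \<le> ?t \<and> \<not> U n \<omega> \<le> ?W \<omega>}
      = joint_cdf \<kappa> ?t - (LINT \<omega>|M. joint_cdf \<kappa> (inf ?t (?W \<omega>)))"
    using inf_eq by linarith
  moreover have "(LINT \<omega>|M. n * (1 - joint_cdf \<kappa> (inf ?t (?W \<omega>))))
      = n * (1 - (LINT \<omega>|M. joint_cdf \<kappa> (inf ?t (?W \<omega>))))"
    using int by (simp add: M.prob_space)
  ultimately have "n * M.prob {\<omega> \<in> space M. U n \<omega> \<le> ?t \<and> \<not> U n \<omega> \<le> ?W \<omega>}
      = (LINT \<omega>|M. n * (1 - joint_cdf \<kappa> (inf ?t (?W \<omega>)))) - rescaled n y"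
    by (simp only: rescaled_def right_diff_distrib)
  also have "(LINT \<omega>|M. n * (1 - joint_cdf \<kappa> (inf ?t (?W \<omega>)))) = (LINT v|max_law n. rescaled n (inf y v))"
  proof -
    \<comment> \<open>The map from \<open>v\<close> to \<open>1 + v / n\<close> is increasing in
      each coordinate and so commutes with \<open>inf\<close>.\<close>
    have eq: "inf ?t w = 1 + inf y (n *\<^sub>R (w - 1)) /\<^sub>R n" for w
      using n by (simp add: vec_eq_iff inf_vec_def inf_real_def min_def field_simps)
    have "rescaled n \<in> borel_measurable borel"
      by (intro borel_measurable_continuous_onI lipschitz_on_continuous_on[OF rescaled_lipschitz])
    then show ?thesis
      unfolding max_law_def using measurable_rescaled_max[OF n]
      by (subst integral_distr) (auto simp: rescaled_def eq)
  qed
  finally show ?thesis .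
qed

end

section \<open>The limit law and the limit of the record probabilities\<close>

text \<open>At 0 the distribution function is 1, so the law lives on the nonpositive orthant. There
  coordinate \<open>i\<close> is at most \<open>- s\<close> exactly when the vector lies below
  \<open>w\<close>, and \<open>N w \<ge> s\<close>.\<close>

lemma (in attracted_copula) exponential_tail_max_stable:
  assumes "prob_space \<rho>" and sets: "sets \<rho> = sets borel"
    and cdf: "\<And>v. v \<le> 0 \<Longrightarrow> joint_cdf \<rho> v = exp (- N v)"
  shows "exponential_tail \<rho>"
proof (intro exponential_tail.intro exponential_tail_axioms.intro)
  show "prob_space \<rho>" "sets \<rho> = sets borel" by fact+
  interpret L: prob_space \<rho> by fact
  note [measurable_cong] = sets
  have "L.prob {..0} = 1"
    using cdf[of 0] by (simp add: N_0 joint_cdf_def)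
  then have "AE v in \<rho>. v \<in> {..0}"
    by (subst (asm) L.prob_eq_1) auto
  then show nonpos: "AE v in \<rho>. v \<le> 0"
    by simp
  fix i and s :: real assume s: "0 \<le> s"
  define w :: "real ^ 'd" where "w = (\<chi> j. if j = i then - s else 0)"
  have w: "w \<le> 0" "w $ i = - s"
    using s by (auto simp: w_def less_eq_vec_def)
  have "L.prob {v. v $ i \<le> - s} = L.prob {..w}"
  proof (rule measure_eq_AE)
    show "AE v in \<rho>. v \<in> {v. v $ i \<le> - s} \<longleftrightarrow> v \<in> {..w}"
      using nonpos by eventually_elim (auto simp: w_def less_eq_vec_def)
  qed auto
  also have "\<dots> = exp (- N w)"
    using cdf[OF w(1)] by (simp add: joint_cdf_def)
  also have "\<dots> \<le> exp (- s / 2)"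
    using minus_component_le_N[OF w(1), of i] w(2) s by simp
  finally show "L.prob {v. v $ i \<le> - s} \<le> exp (- s / 2)" .
qed

text \<open>Makes the denominator of \<open>H_D\<close> nonzero: the orthant below \<open>-1\<close>
  has positive mass, and there \<open>N\<close> is at least 1.\<close>

lemma (in attracted_copula) integral_max_stable_pos:
  assumes "prob_space \<rho>" and sets: "sets \<rho> = sets borel"
    and cdf: "\<And>v. v \<le> 0 \<Longrightarrow> joint_cdf \<rho> v = exp (- N v)"
  shows "0 < (LINT v|\<rho>. N v)"
proof -
  interpret L: exponential_tail \<rho>
    using assms by (rule exponential_tail_max_stable)
  note [measurable_cong] = sets
  have "0 < L.prob {..-1}"
    using cdf[of "-1"] by (simp add: joint_cdf_def less_eq_vec_def)
  also have "\<dots> = (LINT v|\<rho>. indicator {..-1} v)"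
    by simp
  also have "\<dots> \<le> (LINT v|\<rho>. N v)"
  proof (rule integral_mono_AE)
    show "integrable \<rho> (\<lambda>v. indicator {..-1} v :: real)"
      by (simp add: L.emeasure_eq_measure)
    show "integrable \<rho> N"
      by (rule L.integrable_lipschitz[OF N_lipschitz])
    show "AE v in \<rho>. indicator {..-1} v \<le> N v"
      using L.AE_nonpos
    proof eventually_elim
      case (elim v)
      then have "- v $ i \<le> N v" "v $ i \<le> 0" for i
        by (auto simp: less_eq_vec_def intro: minus_component_le_N)
      then have "- v $ i \<le> N v" "v $ i \<le> 0" "v \<le> -1 \<Longrightarrow> v $ i \<le> -1" for i
        by (auto simp: less_eq_vec_def)
      \<comment> \<open>Any coordinate will do; \<open>undefined\<close> names one.\<close>
      from this[of undefined] have "0 \<le> N v" "v \<le> -1 \<Longrightarrow> 1 \<le> N v"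
        by linarith+
      then show ?case
        by (auto simp: indicator_def)
    qed
  qed
  finally show ?thesis .
qed

locale iid_attracted_sample = iid_copula_sample M \<kappa> U + attracted_copula \<kappa> N
  for M :: "'a measure" and \<kappa> :: "(real ^ 'd) measure" and U N
begin

text \<open>Applied twice: with thresholds tending to \<open>\<psi> x\<close> for the numerator, and
  with threshold 0 for the record probability.\<close>

lemma tendsto_prob_below_and_record:
  assumes \<rho>: "prob_space \<rho>" "sets \<rho> = sets borel"
    and cdf: "\<And>v. v \<le> 0 \<Longrightarrow> joint_cdf \<rho> v = exp (- N v)"
    and y: "y \<longlonglongrightarrow> z" "z \<le> 0"
  shows "(\<lambda>n. real n * M.prob {\<omega> \<in> space M. U n \<omega> \<le> 1 + y n /\<^sub>R real n \<and> \<not> U n \<omega> \<le> previous_max n \<omega>})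
    \<longlonglongrightarrow> (LINT v|\<rho>. N (inf z v)) - N z"
proof (rule LIMSEQ_offset[where k = 2])
  \<comment> \<open>Two terms are skipped because the law of the past maximum is controlled only
    from \<open>n = 2\<close> on.\<close>
  let ?y = "\<lambda>n. y (n + 2)"
  have lip_inf: "CARD('d)-lipschitz_on UNIV (\<lambda>v. h (inf u v))"
    if h: "CARD('d)-lipschitz_on UNIV h" for h :: "real ^ 'd \<Rightarrow> real" and u
  proof (rule lipschitz_onI)
    fix v w :: "real ^ 'd"
    have "dist (h (inf u v)) (h (inf u w)) \<le> CARD('d) * dist (inf u v) (inf u w)"
      using lipschitz_onD[OF h] by simp
    also have "\<dots> \<le> CARD('d) * dist v w"
      unfolding dist_norm
      by (intro mult_left_mono norm_le_componentwise_cart) (auto simp: inf_vec_def inf_real_def min_def)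
    finally show "dist (h (inf u v)) (h (inf u w)) \<le> CARD('d) * dist v w" .
  qed simp
  \<comment> \<open>Since \<open>inf z v \<le> z \<le> 0\<close>, the limiting argument lies in the
    orthant where the limit is known, whatever \<open>v\<close> is.\<close>
  have resc: "(\<lambda>n. rescaled n (inf (y n) v)) \<longlonglongrightarrow> N (inf z v)" for v
  proof (rule tendsto_rescaled_seq)
    show "(\<lambda>n. inf (y n) v) \<longlonglongrightarrow> inf z v"
      unfolding inf_vec_def inf_real_def by (intro tendsto_vec_lambda tendsto_min tendsto_vec_nth y tendsto_const)
    show "inf z v \<le> 0"
      using y(2) by (rule le_infI1)
  qed
  have "(\<lambda>n. LINT v|max_law (n + 2). rescaled (n + 2) (inf (?y n) v)) \<longlonglongrightarrow> (LINT v|\<rho>. N (inf z v))"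
  proof (rule tendsto_integral_lipschitz)
    show "exponential_tail (max_law (n + 2))" for n
      by (rule exponential_tail_max_law) simp
    show "exponential_tail \<rho>"
      using \<rho> cdf by (rule exponential_tail_max_stable)
    show "(\<lambda>n. joint_cdf (max_law (n + 2)) v) \<longlonglongrightarrow> joint_cdf \<rho> v" if "v \<le> 0" for v
      using LIMSEQ_ignore_initial_segment[OF tendsto_joint_cdf_power_pred[OF that], of 2]
      by (subst joint_cdf_max_law) (auto simp: cdf[OF that])
    show "CARD('d)-lipschitz_on UNIV (\<lambda>v. rescaled (n + 2) (inf (?y n) v))" for n
      by (rule lip_inf[OF rescaled_lipschitz])
    show "CARD('d)-lipschitz_on UNIV (\<lambda>v. N (inf z v))"
      by (rule lip_inf[OF N_lipschitz])
    show "(\<lambda>n. rescaled (n + 2) (inf (?y n) v)) \<longlonglongrightarrow> N (inf z v)" for v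
      using resc by (rule LIMSEQ_ignore_initial_segment)
  qed
  then have "(\<lambda>n. (LINT v|max_law (n + 2). rescaled (n + 2) (inf (?y n) v)) - rescaled (n + 2) (?y n))
      \<longlonglongrightarrow> (LINT v|\<rho>. N (inf z v)) - N z"
    using LIMSEQ_ignore_initial_segment[OF tendsto_rescaled_seq[OF y], of 2] by (rule tendsto_diff)
  then show "(\<lambda>n. real (n + 2) * M.prob {\<omega> \<in> space M. U (n + 2) \<omega> \<le> 1 + ?y n /\<^sub>R real (n + 2)
        \<and> \<not> U (n + 2) \<omega> \<le> previous_max (n + 2) \<omega>})
    \<longlonglongrightarrow> (LINT v|\<rho>. N (inf z v)) - N z"
    by (subst prob_below_and_record) auto
qed

end

section \<open>Simple records\<close>

text \<open>From \<open>n = 2\<close> on, the extended-real supremum runs over a finite nonempty set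
  of reals and is their maximum.\<close>

lemma simple_record_iff:
  assumes "2 \<le> n"
  shows "simple_record X n \<omega> \<longleftrightarrow> \<not> X n \<omega> \<le> (\<chi> j. MAX k\<in>{1..<n}. X k \<omega> $ j)"
proof -
  have "(SUP k\<in>{1..<n}. ereal (X k \<omega> $ j)) = ereal (MAX k\<in>{1..<n}. X k \<omega> $ j)" for j
  proof -
    have "(SUP k\<in>{1..<n}. ereal (X k \<omega> $ j)) = (MAX k\<in>{1..<n}. ereal (X k \<omega> $ j))"
      using assms by (intro Max_Sup[symmetric]) auto
    also have "\<dots> = ereal (MAX k\<in>{1..<n}. X k \<omega> $ j)"
      using assms by (subst mono_Max_commute[where f = ereal]) (auto simp: image_image mono_def)
    finally show ?thesis .
  qed
  then show ?thesis
    by (simp add: simple_record_def less_eq_vec_def)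
qed

text \<open>Monotone maps commute with finite maxima; this turns the past maximum of the
  observations into that of the transformed sample.\<close>

lemma cdf_transform_max:
  fixes \<mu> :: "(real ^ 'd) measure"
  assumes "prob_space \<mu>" "sets \<mu> = sets borel" and "finite K" "K \<noteq> {}"
  shows "cdf_transform \<mu> (\<chi> j. MAX k\<in>K. x k $ j) = (\<chi> j. MAX k\<in>K. cdf_transform \<mu> (x k) $ j)"
proof -
  have "mono (cdf (margin \<mu> j))" for j
    using real_distribution_margin[OF assms(1,2), of j]
    by (intro monoI finite_borel_measure.cdf_nondecreasing real_distribution.finite_borel_measure_M)
  then show ?thesis
    using assms(3,4)
    by (simp add: cdf_transform_def vec_eq_iff mono_Max_commute image_image)
qed

lemma cdf_transform_le_1:
  fixes \<mu> :: "(real ^ 'd) measure"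
  assumes "prob_space \<mu>" "sets \<mu> = sets borel"
  shows "cdf_transform \<mu> x \<le> 1"
  using real_distribution.cdf_bounded_prob[OF real_distribution_margin[OF assms]]
  by (simp add: cdf_transform_def less_eq_vec_def)

section \<open>Transfer to the original sample and conclusion\<close>

theorem corollary4p2:
  fixes M :: "'a measure" and X :: "nat \<Rightarrow> 'a \<Rightarrow> real ^ 'd" and \<mu> :: "(real ^ 'd) measure"
    and N :: "real ^ 'd \<Rightarrow> real"
    and E :: "'e measure" and \<eta> :: "'e \<Rightarrow> real ^ 'd"
    and G :: "'d \<Rightarrow> real \<Rightarrow> real"
    and a b :: "nat \<Rightarrow> real ^ 'd"
    and \<psi> :: "real ^ 'd \<Rightarrow> real ^ 'd"
    and x :: "real ^ 'd"
  assumes "prob_space M"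
    and "prob_space.indep_vars M (\<lambda>_. borel) X {1..}"
    and "\<And>n. n \<ge> 1 \<Longrightarrow> distr M borel (X n) = \<mu>"
    and "continuous_on UNIV (joint_cdf \<mu>)"
    and "D_norm N"
    and "copula_domain_of_attraction (copula \<mu>) (std_max_stable N)"
    and "prob_space E"
    and "\<eta> \<in> borel_measurable E"
    and "\<And>y. y \<le> 0 \<Longrightarrow> joint_cdf (distr E borel \<eta>) y = std_max_stable N y"
    and "\<And>i. max_stable (G i)"
    and "\<And>n i. n \<ge> 1 \<Longrightarrow> a n $ i > 0"
    and "\<And>i t. G i t > 0 \<Longrightarrow>
           (\<lambda>n. real n * (1 - cdf (margin \<mu> i) (a n $ i * t + b n $ i))) \<longlonglongrightarrow> - ln (G i t)"
    and "\<And>z. \<psi> z = (\<chi> i. ln (G i (z $ i)))"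
    and "\<And>i. G i (x $ i) > 0"
  shows "(\<lambda>n. \<P>(\<omega> in M. (\<chi> i. (X n \<omega> $ i - b n $ i) / a n $ i) \<le> x \<bar> simple_record X n \<omega>))
           \<longlonglongrightarrow> H_D N E \<eta> (\<psi> x)"
proof -
  interpret M: prob_space M by fact
  interpret E: prob_space E by fact
  have X: "X n \<in> borel_measurable M" if "1 \<le> n" for n
    using assms(2) that by (auto simp: M.indep_vars_def)
  have mu_prob: "prob_space \<mu>"
    using M.prob_space_distr[OF X[of 1]] assms(3)[of 1] by simp
  have mu_sets: "sets \<mu> = sets borel"
    by (subst assms(3)[of 1, symmetric]) simp_all
  note mu = mu_prob mu_sets assms(4)
  define T where "T = cdf_transform \<mu>"
  define \<kappa> where "\<kappa> = distr \<mu> borel T"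
  define U where "U n \<omega> = T (X n \<omega>)" for n \<omega>
  have T: "T \<in> borel_measurable borel"
    unfolding T_def by (rule measurable_cdf_transform[OF mu])
  then have T': "T \<in> borel_measurable \<mu>"
    by (simp add: measurable_cong_sets[OF mu_sets refl])
  interpret \<kappa>: copula_law \<kappa>
  proof (intro copula_law.intro copula_law_axioms.intro)
    show "prob_space \<kappa>"
      unfolding \<kappa>_def using T' by (intro prob_space.prob_space_distr mu_prob)
  qed (auto simp: \<kappa>_def T_def measure_cdf_transform_margin[OF mu])
  interpret iid_attracted_sample M \<kappa> U N
  proof unfold_locales
    show "M.indep_vars (\<lambda>_. borel) U {1..}"
      unfolding U_def using assms(2) T by (rule M.indep_vars_compose2)
    show "distr M borel (U n) = \<kappa>" if "1 \<le> n" for n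
      using distr_distr[OF T X[OF that]] assms(3)[OF that] by (simp add: \<kappa>_def U_def[abs_def] comp_def)
    show "N v = N (- (\<chi> i. \<bar>v $ i\<bar>))" for v
      using assms(5) by (auto simp: D_norm_def)
    show "(\<lambda>n. joint_cdf \<kappa> (1 + v /\<^sub>R real n) ^ n) \<longlonglongrightarrow> exp (- N v)" if v: "v \<le> 0" for v
    proof (rule Lim_transform_eventually)
      show "(\<lambda>n. copula \<mu> (1 + v /\<^sub>R real n) ^ n) \<longlonglongrightarrow> exp (- N v)"
        using assms(6) v by (simp add: copula_domain_of_attraction_def std_max_stable_def)
      \<comment> \<open>Once \<open>n > n0\<close>, the point \<open>1 + v / n\<close> lies in the
        unit cube, where \<open>copula \<mu>\<close> and \<open>joint_cdf \<kappa>\<close>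
        agree.\<close>
      obtain n0 :: nat where n0: "Max (range (\<lambda>i. - v $ i)) \<le> n0"
        using real_arch_simple by blast
      show "\<forall>\<^sub>F n in sequentially. copula \<mu> (1 + v /\<^sub>R real n) ^ n = joint_cdf \<kappa> (1 + v /\<^sub>R real n) ^ n"
        using eventually_ge_at_top[of "Suc n0"]
      proof eventually_elim
        case (elim n)
        have "- v $ i \<le> n0" "v $ i \<le> 0" "real n0 \<le> n" for i
          using n0 v elim by (auto simp: less_eq_vec_def)
        then have "0 \<le> real n + v $ i" "v $ i \<le> 0" for i
          by (smt (verit))+
        then have "copula \<mu> (1 + v /\<^sub>R real n) = joint_cdf \<kappa> (1 + v /\<^sub>R real n)"
          unfolding \<kappa>_def T_def using elim
          by (intro copula_eq_joint_cdf[OF mu]) (auto simp: field_simps)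
        then show ?case by simp
      qed
    qed
  qed
  define \<rho> where "\<rho> = distr E borel \<eta>"
  have rho: "prob_space \<rho>" "sets \<rho> = sets borel" "\<And>v. v \<le> 0 \<Longrightarrow> joint_cdf \<rho> v = exp (- N v)"
    using assms(8,9) by (auto simp: \<rho>_def std_max_stable_def intro: E.prob_space_distr)
  interpret \<rho>: exponential_tail \<rho>
    using rho by (rule exponential_tail_max_stable)
  \<comment> \<open>\<open>t n\<close> is the threshold \<open>x\<close> with its normalization
    undone; \<open>y n\<close> is chosen so that \<open>T (t n) = 1 + y n / n\<close> for
    \<open>n > 0\<close>.\<close>
  define t where "t n = (\<chi> i. a n $ i * x $ i + b n $ i)" for n
  define y where "y n = real n *\<^sub>R (T (t n) - 1)" for n
  \<comment> \<open>In each coordinate this is the marginal domain of attraction condition at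
    \<open>x\<close> with the sign reversed.\<close>
  have y_lim: "y \<longlonglongrightarrow> \<psi> x"
  proof (rule vec_tendstoI)
    fix i
    have "y n $ i = - (real n * (1 - cdf (margin \<mu> i) (a n $ i * x $ i + b n $ i)))" for n
      by (simp add: y_def T_def cdf_transform_def t_def algebra_simps)
    then show "(\<lambda>n. y n $ i) \<longlonglongrightarrow> \<psi> x $ i"
      using tendsto_minus[OF assms(12)[OF assms(14)[of i]]] by (simp add: assms(13))
  qed
  \<comment> \<open>Transformed values never exceed 1, so every \<open>y n\<close> is nonpositive,
    and so is the limit.\<close>
  have psi: "\<psi> x \<le> 0"
  proof -
    have "y n $ i \<le> 0" for n i
      using cdf_transform_le_1[OF mu(1,2), of "t n"]
      by (auto simp: y_def T_def less_eq_vec_def mult_le_0_iff)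
    then show ?thesis
      unfolding less_eq_vec_def
      by (intro allI tendsto_upperbound[OF tendsto_vec_nth[OF y_lim]]) auto
  qed
  let ?below = "\<lambda>n \<omega>. (\<chi> i. (X n \<omega> $ i - b n $ i) / a n $ i) \<le> x"
  let ?P = "\<lambda>n z. real n * M.prob {\<omega> \<in> space M. U n \<omega> \<le> 1 + z /\<^sub>R real n \<and> \<not> U n \<omega> \<le> previous_max n \<omega>}"
  have num: "M.prob {\<omega> \<in> space M. ?below n \<omega> \<and> simple_record X n \<omega>} = ?P n (y n) / n"
    and den: "M.prob {\<omega> \<in> space M. simple_record X n \<omega>} = ?P n 0 / n" if n: "2 \<le> n" for n
  proof -
    define W where "W \<omega> = (\<chi> j. MAX k\<in>{1..<n}. X k \<omega> $ j)" for \<omega>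
    have [measurable]: "X k \<in> borel_measurable M" "U k \<in> borel_measurable M" if "1 \<le> k" for k
      using X[OF that] measurable_U[OF that] by auto
    note [measurable] = measurable_previous_max[OF n]
    have [measurable]: "X n \<in> borel_measurable M" "U n \<in> borel_measurable M"
      using X[of n] measurable_U[of n] n by auto
    have W[measurable]: "W \<in> borel_measurable M"
      unfolding W_def
      using X by (intro borel_measurable_vec_lambda borel_measurable_Max measurable_compose[of _ M borel "\<lambda>u. u $ _"]) auto
    have below: "?below n \<omega> \<longleftrightarrow> X n \<omega> \<le> t n" for \<omega>
      using assms(11)[of n] n by (auto simp: less_eq_vec_def t_def field_simps)
    have rec: "simple_record X n \<omega> \<longleftrightarrow> \<not> X n \<omega> \<le> W \<omega>" for \<omega>
      using simple_record_iff[OF n] by (simp add: W_def)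
    have TW: "T (W \<omega>) = previous_max n \<omega>" for \<omega>
      using n unfolding T_def W_def by (subst cdf_transform_max[OF mu(1,2)]) (auto simp: previous_max_def U_def T_def)
    have yn: "1 + y n /\<^sub>R real n = T (t n)"
      using n by (simp add: y_def)
    have "AE v in distr M borel (X n). \<forall>s. T v \<le> T s \<longleftrightarrow> v \<le> s"
      using assms(3)[of n] n unfolding T_def by (simp only:) (rule AE_cdf_transform_le_iff[OF mu])
    \<comment> \<open>Used below with \<open>s\<close> equal to \<open>t n\<close> and to the random
      vector \<open>W \<omega>\<close>.\<close>
    then have ae: "AE \<omega> in M. \<forall>s. U n \<omega> \<le> T s \<longleftrightarrow> X n \<omega> \<le> s"
      using n unfolding U_def by (intro AE_distrD[of "X n"]) auto
    have "M.prob {\<omega> \<in> space M. ?below n \<omega> \<and> simple_record X n \<omega>}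
        = M.prob {\<omega> \<in> space M. U n \<omega> \<le> 1 + y n /\<^sub>R real n \<and> \<not> U n \<omega> \<le> previous_max n \<omega>}"
    proof (rule measure_eq_AE)
      show "AE \<omega> in M. \<omega> \<in> {\<omega> \<in> space M. ?below n \<omega> \<and> simple_record X n \<omega>} \<longleftrightarrow>
          \<omega> \<in> {\<omega> \<in> space M. U n \<omega> \<le> 1 + y n /\<^sub>R real n \<and> \<not> U n \<omega> \<le> previous_max n \<omega>}"
        using ae by eventually_elim (simp add: below rec yn TW[symmetric])
    qed (unfold below rec, measurable)
    then show "M.prob {\<omega> \<in> space M. ?below n \<omega> \<and> simple_record X n \<omega>} = ?P n (y n) / n"
      using n by simp
    \<comment> \<open>The threshold is now 1, which \<open>U n \<omega>\<close> never exceeds, so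
      only the record condition is left.\<close>
    have "M.prob {\<omega> \<in> space M. simple_record X n \<omega>}
        = M.prob {\<omega> \<in> space M. U n \<omega> \<le> 1 + 0 /\<^sub>R real n \<and> \<not> U n \<omega> \<le> previous_max n \<omega>}"
    proof (rule measure_eq_AE)
      show "AE \<omega> in M. \<omega> \<in> {\<omega> \<in> space M. simple_record X n \<omega>} \<longleftrightarrow>
          \<omega> \<in> {\<omega> \<in> space M. U n \<omega> \<le> 1 + 0 /\<^sub>R real n \<and> \<not> U n \<omega> \<le> previous_max n \<omega>}"
        using ae
        by eventually_elim
          (simp add: rec TW[symmetric] U_def T_def cdf_transform_le_1[OF mu(1,2)])
    qed (unfold rec, measurable)
    then show "M.prob {\<omega> \<in> space M. simple_record X n \<omega>} = ?P n 0 / n"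
      using n by simp
  qed
  have "(\<lambda>n. ?P n (y n)) \<longlonglongrightarrow> (LINT v|\<rho>. N (inf (\<psi> x) v)) - N (\<psi> x)"
    by (rule tendsto_prob_below_and_record[OF rho y_lim psi])
  moreover have "(\<lambda>n. ?P n 0) \<longlonglongrightarrow> (LINT v|\<rho>. N (inf 0 v)) - N 0"
    by (rule tendsto_prob_below_and_record[OF rho tendsto_const order_refl])
  moreover have N_meas: "N \<in> borel_measurable borel"
    by (intro borel_measurable_continuous_onI lipschitz_on_continuous_on[OF N_lipschitz])
  \<comment> \<open>The limit law lives on the nonpositive orthant, where the minimum with 0 changes
    nothing.\<close>
  have "(LINT v|\<rho>. N (inf 0 v)) = (LINT v|\<rho>. N v)"
  proof (rule integral_cong_AE)
    show "AE v in \<rho>. N (inf 0 v) = N v"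
      using \<rho>.AE_nonpos by eventually_elim (simp add: inf_absorb2)
  qed (use N_meas rho(2) in measurable)
  moreover note N_0
  moreover have "0 < (LINT v|\<rho>. N v)"
    using rho by (rule integral_max_stable_pos)
  \<comment> \<open>In this ratio the factor \<open>n\<close> cancels, so it is the conditional
    probability for \<open>n \<ge> 2\<close>.\<close>
  ultimately have "(\<lambda>n. ?P n (y n) / ?P n 0) \<longlonglongrightarrow>
      ((LINT v|\<rho>. N (inf (\<psi> x) v)) - N (\<psi> x)) / (LINT v|\<rho>. N v)"
    by (intro tendsto_divide) auto
  also have "((LINT v|\<rho>. N (inf (\<psi> x) v)) - N (\<psi> x)) / (LINT v|\<rho>. N v) = H_D N E \<eta> (\<psi> x)"
    unfolding H_D_def \<rho>_def using N_meas assms(8)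
    by (subst (1 2) integral_distr) auto
  finally show ?thesis
  proof (rule Lim_transform_eventually)
    show "\<forall>\<^sub>F n in sequentially. ?P n (y n) / ?P n 0 = \<P>(\<omega> in M. ?below n \<omega> \<bar> simple_record X n \<omega>)"
      using eventually_ge_at_top[of 2]
      by eventually_elim (simp add: cond_prob_def num den)
  qed
qed

end
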